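(* Let $f_i:\mathcal H\to(-\infty,+\infty]$ be proper, closed and $\sigma_i$-convex ($\sigma_i\in\mathbb R$) for each $i=1,\dots,m$, and suppose $\operatorname{zer}(\partial f_1+\cdots+\partial f_m)\ne\emptyset$. Let $\mu\in(0,2)$ and $\lambda_1,\dots,\lambda_{m-1}\in(0,+\infty)$ with $\sum_{i=1}^{m-1}\lambda_i=1$. Suppose that one of the following holds: (A) (Nonconvex case) there exists $j\in\{1,\dots,m\}$ such that $\sigma_j<0$, $\sigma_m\ne0$, $\sum_{i=1}^m\sigma_i>0$, and $\bar\lambda^*$ is the optimal value of the maximization problem (P) described in the context; (B) (Convex case) $\sigma_i\ge0$ for all $i=1,\dots,m$, and $\bar\lambda^*=+\infty$. Let $\lambda\in(0,\bar\lambda^* )$ and let $\{(x_1^k,\dots,x_{m-1}^k,z_1^k,\dots,z_{m-1}^k,y^k)\}_{k\ge0}$ be generated from an arbitrary initial point $(x_1^0,\dots,x_{m-1}^0)\in\mathcal H^{m-1}$ by $$z_i^k\in\operatorname{prox}_{\frac{\lambda}{\lambda_i}f_i}(x_i^k)\ (i=1,\dots,m-1),\quad y^k\in\operatorname{prox}_{\lambda f_m}\Big(\sum_{i=1}^{m-1}\lambda_i(2z_i^k-x_i^k)\Big),\quad x_i^{k+1}=x_i^k+\mu(y^k-z_i^k)\ (i=1,\dots,m-1).$$ Then: (i) $\{x_i^k\}$, $\{y^k\}$ and $\{z_i^k\}$ are bounded for $i=1,\dots,m-1$; (ii) $\|x_i^{k+1}-x_i^k\|=o(1/\sqrt k)$,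 $\|y^{k+1}-y^k\|=o(1/\sqrt k)$ and $\|z_i^{k+1}-z_i^k\|=o(1/\sqrt k)$ as $k\to\infty$, for $i=1,\dots,m-1$; (iii) if (A) holds, or (B) holds with $\sigma_j>0$ for some $j\in\{1,\dots,m\}$, then the problem $\min_{x\in\mathcal H}f_1(x)+\cdots+f_m(x)$ has a unique solution $\bar z$, and the sequences $\{z_i^k\}$ ($i=1,\dots,m-1$) and $\{y^k\}$ converge strongly to $\bar z$; (iv) if (B) holds with $\sigma_i=0$ for all $i=1,\dots,m$, then there exists $\bar z\in\operatorname{argmin}(\sum_{i=1}^mf_i)$ such that the sequences $\{z_i^k\}$ ($i=1,\dots,m-1$) and $\{y^k\}$ converge weakly to $\bar z$.
   Context: $\mathcal H$ is a real Hilbert space, $m\ge2$. $f$ is closed if it is lower semicontinuous, and $\sigma$-convex if $f-\frac\sigma2\|\cdot\|^2$ is convex. $\operatorname{prox}_{\gamma f}(x)=\operatorname{argmin}_{w\in\mathcal H}f(w)+\frac1{2\gamma}\|w-x\|^2$ for $\gamma>0$. The subdifferential $\partial f(x)$ at $x\in\operatorname{dom}f$ is the set of $z\in\mathcal H$ for which there are sequences $x^k\to x$ with $f(x^k)\to f(x)$ and $z^k\to z$, $z^k\in\hat\partial f(x^k)$, where $\hat\partial f(x)=\{z:\liminf_{\bar x\to x,\bar x\ne x}\frac{f(\bar x)-f(x)-\langle z,\bar x-x\rangle}{\|\bar x-x\|}\ge0\}$; $\partial f(x)=\emptyset$ if $x\notin\operatorname{dom}f$. For a set-valued operator $A$, $\operatorname{zer}A=\{x:0\in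 A(x)\}$. Problem (P): let $\mathcal I=\{i\in\{1,\dots,m-1\}:\sigma_i\ne0\}$. Maximize $\bar\lambda\ge0$ over $\delta=(\delta_i)_{i\in\mathcal I}\in\mathbb R^{|\mathcal I|}$ and $\bar\lambda\ge0$ subject to $\sum_{i\in\mathcal I}\delta_i=1$, $\sigma_i+\sigma_m\delta_i\ge0$ for all $i\in\mathcal I$, and $$1+\frac{\bar\lambda}{\lambda_i}\,\frac{\sigma_i\sigma_m\delta_i}{\sigma_i+\sigma_m\delta_i}-\frac\mu2\ge0\quad\text{for all }i\in\mathcal I,$$ where, if $\sigma_i+\sigma_m\delta_i=0$, the last constraint is understood to hold only for $\bar\lambda=0$. *)

theory Defs
  imports "HOL-Analysis.Analysis" "HOL-Library.Landau_Symbols"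
begin

definition edom :: "('a \<Rightarrow> ereal) \<Rightarrow> 'a set" where
  "edom f = {x. f x < \<infinity>}"

definition proper_fun :: "('a \<Rightarrow> ereal) \<Rightarrow> bool" where
  "proper_fun f \<longleftrightarrow> (\<forall>x. f x \<noteq> -\<infinity>) \<and> edom f \<noteq> {}"

definition closed_fun :: "('a::topological_space \<Rightarrow> ereal) \<Rightarrow> bool" where
  "closed_fun f \<longleftrightarrow> (\<forall>x. f x \<le> Liminf (at x) f)"

text \<open>Meant for functions that avoid \<open>-\<infinity>\<close>. The weights are strictly positive, so the right-hand
  side is \<open>\<infinity>\<close> as soon as one of the two values is.\<close>

definition convex_fun :: "('a::real_vector \<Rightarrow> ereal) \<Rightarrow> bool" where
  "convex_fun f \<longleftrightarrow> (\<forall>x y u v. u > 0 \<longrightarrow> v > 0 \<longrightarrow> u + v = 1 \<longrightarrow>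
     f (u *\<^sub>R x + v *\<^sub>R y) \<le> ereal u * f x + ereal v * f y)"

definition sigma_convex :: "real \<Rightarrow> ('a::real_inner \<Rightarrow> ereal) \<Rightarrow> bool" where
  "sigma_convex \<sigma> f \<longleftrightarrow> convex_fun (\<lambda>x. f x - ereal (\<sigma> / 2 * (norm x)\<^sup>2))"

definition argmin :: "('a \<Rightarrow> ereal) \<Rightarrow> 'a set" where
  "argmin g = {w. is_arg_min g (\<lambda>_. True) w}"

definition prox :: "real \<Rightarrow> ('a::real_inner \<Rightarrow> ereal) \<Rightarrow> 'a \<Rightarrow> 'a set" where
  "prox \<gamma> f x = argmin (\<lambda>w. f w + ereal (1 / (2 * \<gamma>) * (norm (w - x))\<^sup>2))"

text \<open>Outside the domain the regular subdifferential is empty by convention; the difference quotient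
  would be meaningless there, since \<open>\<infinity> - \<infinity> = \<infinity>\<close> in type \<open>ereal\<close>.\<close>

definition regular_subdiff :: "('a::real_inner \<Rightarrow> ereal) \<Rightarrow> 'a \<Rightarrow> 'a set" where
  "regular_subdiff f x = {z. x \<in> edom f \<and>
     0 \<le> Liminf (at x) (\<lambda>y. (f y - f x - ereal (z \<bullet> (y - x))) / ereal (norm (y - x)))}"

definition subdiff :: "('a::real_inner \<Rightarrow> ereal) \<Rightarrow> 'a \<Rightarrow> 'a set" where
  "subdiff f x = {z. x \<in> edom f \<and> (\<exists>(xs :: nat \<Rightarrow> 'a) (zs :: nat \<Rightarrow> 'a).
     xs \<longlonglongrightarrow> x \<and> (\<lambda>k. f (xs k)) \<longlonglongrightarrow> f x \<and> zs \<longlonglongrightarrow> z \<and> (\<forall>k. zs k \<in> regular_subdiff f (xs k)))}"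

definition zer :: "('a \<Rightarrow> 'b::zero set) \<Rightarrow> 'a set" where
  "zer A = {x. 0 \<in> A x}"

definition weakly_tendsto :: "(nat \<Rightarrow> 'a::real_inner) \<Rightarrow> 'a \<Rightarrow> bool" where
  "weakly_tendsto xs l \<longleftrightarrow> (\<forall>u. (\<lambda>k. xs k \<bullet> u) \<longlonglongrightarrow> l \<bullet> u)"

definition index_set :: "nat \<Rightarrow> (nat \<Rightarrow> real) \<Rightarrow> nat set" where
  "index_set m \<sigma> = {i \<in> {1..<m}. \<sigma> i \<noteq> 0}"

text \<open>Only the components of \<open>\<delta>\<close> with index in \<open>index_set m \<sigma>\<close> matter.\<close>

definition P_feasible ::
  "nat \<Rightarrow> (nat \<Rightarrow> real) \<Rightarrow> real \<Rightarrow> (nat \<Rightarrow> real) \<Rightarrow> (nat \<Rightarrow> real) \<Rightarrow> real \<Rightarrow> bool" where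
  "P_feasible m \<sigma> \<mu> lam \<delta> lbar \<longleftrightarrow>
     lbar \<ge> 0 \<and>
     (\<Sum>i\<in>index_set m \<sigma>. \<delta> i) = 1 \<and>
     (\<forall>i\<in>index_set m \<sigma>. \<sigma> i + \<sigma> m * \<delta> i \<ge> 0) \<and>
     (\<forall>i\<in>index_set m \<sigma>.
        if \<sigma> i + \<sigma> m * \<delta> i = 0 then lbar = 0
        else 1 + lbar / lam i * (\<sigma> i * \<sigma> m * \<delta> i / (\<sigma> i + \<sigma> m * \<delta> i)) - \<mu> / 2 \<ge> 0)"

definition P_optval :: "nat \<Rightarrow> (nat \<Rightarrow> real) \<Rightarrow> real \<Rightarrow> (nat \<Rightarrow> real) \<Rightarrow> ereal" where
  "P_optval m \<sigma> \<mu> lam = Sup {ereal lbar | lbar. \<exists>\<delta>. P_feasible m \<sigma> \<mu> lam \<delta> lbar}"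

definition nonconvex_case ::
  "nat \<Rightarrow> (nat \<Rightarrow> real) \<Rightarrow> real \<Rightarrow> (nat \<Rightarrow> real) \<Rightarrow> ereal \<Rightarrow> bool" where
  "nonconvex_case m \<sigma> \<mu> lam lstar \<longleftrightarrow>
     (\<exists>j\<in>{1..m}. \<sigma> j < 0) \<and> \<sigma> m \<noteq> 0 \<and> (\<Sum>i=1..m. \<sigma> i) > 0 \<and> lstar = P_optval m \<sigma> \<mu> lam"

definition convex_case :: "nat \<Rightarrow> (nat \<Rightarrow> real) \<Rightarrow> ereal \<Rightarrow> bool" where
  "convex_case m \<sigma> lstar \<longleftrightarrow> (\<forall>i\<in>{1..m}. \<sigma> i \<ge> 0) \<and> lstar = \<infinity>"

end

theory Submission
  imports Defs
begin

text \<open>A proximal step is an inclusion: if \<open>z \<in> prox g f x\<close> and \<open>f\<close> is \<open>\<sigma>\<close>-convex, then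
  \<open>v = (x - z) / g\<close> is a strong subgradient of \<open>f\<close> at \<open>z\<close>, that is
  \<open>f w \<ge> f z + v \<bullet> (w - z) + \<sigma>/2 * |w - z|^2\<close> for all \<open>w\<close>. This is a first order condition along the
  segment from \<open>z\<close> to \<open>w\<close>, so it holds for every real \<open>\<sigma>\<close> and for every choice of \<open>z\<close> when the
  proximal map is multivalued. The limiting subdifferential consists of strong subgradients as well.
  Strong subgradients are \<open>\<sigma>\<close>-monotone, and this monotonicity is what drives the iteration.

  Take two steps, and let \<open>p\<^sub>i\<close> and \<open>q\<close> be the differences of their points \<open>z\<^sub>i\<close> and \<open>y\<close>. By
  \<open>energy_decrease\<close>, the energy \<open>\<Sum> lam\<^sub>i * |x\<^sub>i - x'\<^sub>i|^2\<close> between the two decreases at least by the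
  dissipation
  \<open>\<mu> * (2 - \<mu>) * \<Sum> lam\<^sub>i * |q - p\<^sub>i|^2 + 2 * \<mu> * \<gamma> * (\<Sum> \<sigma>\<^sub>i * |p\<^sub>i|^2 + \<sigma>\<^sub>m * |q|^2)\<close>.
  A zero \<open>u\<close> of the sum of the subdifferentials gives a stationary step, and the comparison with it shows
  that the energy relative to the fixed point decreases and that the dissipation is summable. The
  comparison of two successive steps shows that the weighted squared residuals \<open>\<Sum> lam\<^sub>i * |y - z\<^sub>i|^2\<close>
  decrease. A decreasing summable sequence of nonnegative numbers is \<open>o(1/k)\<close>, hence the rates.

  The dissipation must therefore dominate the residuals, although some \<open>\<sigma>\<^sub>i\<close> may be negative. Split
  \<open>\<sigma>\<^sub>m\<close> into \<open>\<tau>\<^sub>i = \<sigma>\<^sub>m * \<delta>\<^sub>i\<close> and complete the square: with \<open>s = \<sigma>\<^sub>i + \<tau>\<^sub>i\<close>,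
  \<open>\<sigma>\<^sub>i * |p|^2 + \<tau>\<^sub>i * |q|^2 = (\<sigma>\<^sub>i * \<tau>\<^sub>i / s) * |q - p|^2 + (1 / s) * |\<sigma>\<^sub>i *\<^sub>R p + \<tau>\<^sub>i *\<^sub>R q|^2\<close>.
  That the total coefficient of \<open>|q - p|^2\<close> be nonnegative is the last constraint of the maximization
  problem at the step size, and the coefficient is positive when the step size is strictly below a
  feasible value. The second square then controls \<open>q\<close> itself. So the dissipation dominates \<open>|y - u|^2\<close> as well
  (\<open>dissipation_margin_feasible\<close>), and \<open>y\<close> converges strongly to \<open>u\<close>. The same happens in the convex
  case when some \<open>\<sigma>\<^sub>j\<close> is positive (\<open>dissipation_margin_convex\<close>).

  If all \<open>\<sigma>\<^sub>i\<close> vanish, the iterates are bounded and only the residuals tend to zero. Weak cluster points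
  exist along filters finer than \<open>sequentially\<close>, by Tychonoff's theorem and the Riesz representation
  (\<open>weak_cluster_point\<close>). Each of them comes from a zero of the sum, by Minty's trick, which tests
  monotonicity at resolvent points (\<open>cluster_point_solution\<close>). As the energies relative to any two fixed points
  converge, Opial's argument shows that all cluster points agree (\<open>cluster_points_unique\<close>).\<close>

section \<open>Strong subgradients\<close>

text \<open>The quadratic term lets one notion serve strongly convex, convex and weakly convex functions,
  according to the sign of \<open>\<sigma>\<close>. Membership of \<open>x\<close> in the domain keeps the value at \<open>x\<close> finite.\<close>

definition strong_subgradients :: "real \<Rightarrow> ('a::real_inner \<Rightarrow> ereal) \<Rightarrow> 'a \<Rightarrow> 'a set" where
  "strong_subgradients \<sigma> f x =
     {v. x \<in> edom f \<and> (\<forall>w. f x + ereal (v \<bullet> (w - x) + \<sigma> / 2 * (norm (w - x))\<^sup>2) \<le> f w)}"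

lemma edom_real:
  assumes "proper_fun f" "x \<in> edom f"
  obtains a where "f x = ereal a"
  using assms by (cases "f x") (auto simp: proper_fun_def edom_def)

text \<open>Adding the two subgradient inequalities cancels the function values.\<close>

lemma strong_subgradients_monotone:
  fixes f :: "'a::real_inner \<Rightarrow> ereal"
  assumes f: "proper_fun f" and v: "v \<in> strong_subgradients \<sigma> f x" and v': "v' \<in> strong_subgradients \<sigma> f x'"
  shows "\<sigma> * (norm (x - x'))\<^sup>2 \<le> (v - v') \<bullet> (x - x')"
proof -
  obtain a b where ab: "f x = ereal a" "f x' = ereal b"
    using edom_real[OF f] v v' by (metis (no_types, lifting) mem_Collect_eq strong_subgradients_def)
  have 1: "f x + ereal (v \<bullet> (x' - x) + \<sigma> / 2 * (norm (x' - x))\<^sup>2) \<le> f x'"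
    using v by (simp add: strong_subgradients_def)
  have 2: "f x' + ereal (v' \<bullet> (x - x') + \<sigma> / 2 * (norm (x - x'))\<^sup>2) \<le> f x"
    using v' by (simp add: strong_subgradients_def)
  show ?thesis
    using 1 2 by (simp add: ab norm_minus_commute inner_diff_left inner_diff_right)
qed

lemma sigma_convex_segment:
  fixes f :: "'a::real_inner \<Rightarrow> ereal"
  assumes f: "sigma_convex \<sigma> f" and ab: "f x = ereal a" "f w = ereal b" and t: "0 < t" "t < 1"
  shows "f (x + t *\<^sub>R (w - x)) \<le> ereal ((1 - t) * a + t * b - \<sigma> / 2 * t * (1 - t) * (norm (w - x))\<^sup>2)"
proof -
  define p where "p = x + t *\<^sub>R (w - x)"
  have p: "(1 - t) *\<^sub>R x + t *\<^sub>R w = p" by (simp add: p_def algebra_simps)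
  have n: "(norm p)\<^sup>2 = (1 - t) * (norm x)\<^sup>2 + t * (norm w)\<^sup>2 - t * (1 - t) * (norm (w - x))\<^sup>2"
    unfolding p[symmetric]
    by (simp add: power2_norm_eq_inner inner_add_left inner_add_right inner_diff_left inner_diff_right inner_commute algebra_simps)
  have "f p - ereal (\<sigma> / 2 * (norm p)\<^sup>2)
      \<le> ereal (1 - t) * (f x - ereal (\<sigma> / 2 * (norm x)\<^sup>2)) + ereal t * (f w - ereal (\<sigma> / 2 * (norm w)\<^sup>2))"
    using f t unfolding sigma_convex_def convex_fun_def p[symmetric] by simp
  then have "f p \<le> ereal ((1 - t) * (a - \<sigma> / 2 * (norm x)\<^sup>2) + t * (b - \<sigma> / 2 * (norm w)\<^sup>2) + \<sigma> / 2 * (norm p)\<^sup>2)"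
    using ab by (cases "f p") (auto simp: algebra_simps)
  also have "(1 - t) * (a - \<sigma> / 2 * (norm x)\<^sup>2) + t * (b - \<sigma> / 2 * (norm w)\<^sup>2) + \<sigma> / 2 * (norm p)\<^sup>2
     = (1 - t) * a + t * b - \<sigma> / 2 * t * (1 - t) * (norm (w - x))\<^sup>2"
    unfolding n by (simp add: field_simps)
  finally show ?thesis by (simp add: p_def)
qed

text \<open>A first order lower bound along segments suffices, because \<open>\<sigma>\<close>-convexity turns the infinitesimal
  information at \<open>x\<close> into the global quadratic minorant. Proximal points and regular subgradients both
  enter through this criterion.\<close>

lemma strong_subgradient_from_directions:
  fixes f :: "'a::real_inner \<Rightarrow> ereal"
  assumes f: "proper_fun f" "sigma_convex \<sigma> f" and x: "x \<in> edom f"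
    and dir: "\<And>w \<epsilon>. \<epsilon> > 0 \<Longrightarrow>
      \<forall>\<^sub>F t in at_right 0. f x + ereal (t * (v \<bullet> (w - x) - \<epsilon>)) \<le> f (x + t *\<^sub>R (w - x))"
  shows "v \<in> strong_subgradients \<sigma> f x"
proof -
  obtain a where a: "f x = ereal a" using edom_real f(1) x by metis
  have "f x + ereal (v \<bullet> (w - x) + \<sigma> / 2 * (norm (w - x))\<^sup>2) \<le> f w" for w
  proof (cases "w \<in> edom f")
    case False
    then show ?thesis by (simp add: edom_def)
  next
    case True
    then obtain b where b: "f w = ereal b" using edom_real f(1) by metis
    have "v \<bullet> (w - x) \<le> b - a - \<sigma> / 2 * (norm (w - x))\<^sup>2 + \<epsilon>" if "\<epsilon> > 0" for \<epsilon>
    proof (rule tendsto_lowerbound)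
      show "((\<lambda>t. b - a - \<sigma> / 2 * (1 - t) * (norm (w - x))\<^sup>2 + \<epsilon>)
          \<longlongrightarrow> b - a - \<sigma> / 2 * (norm (w - x))\<^sup>2 + \<epsilon>) (at_right 0)"
        by (auto intro!: tendsto_eq_intros)
      have "\<forall>\<^sub>F t in at_right (0::real). 0 < t \<and> t < 1"
        by (auto simp: eventually_at_right_field intro!: exI[of _ 1])
      with dir[OF that, of w]
      show "\<forall>\<^sub>F t in at_right 0. v \<bullet> (w - x) \<le> b - a - \<sigma> / 2 * (1 - t) * (norm (w - x))\<^sup>2 + \<epsilon>"
      proof eventually_elim
        case (elim t)
        have "f x + ereal (t * (v \<bullet> (w - x) - \<epsilon>))
           \<le> ereal ((1 - t) * a + t * b - \<sigma> / 2 * t * (1 - t) * (norm (w - x))\<^sup>2)"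
          using elim(1) sigma_convex_segment[OF f(2) a b] elim(2) by (meson order_trans)
        then have "t * (v \<bullet> (w - x)) \<le> t * (b - a - \<sigma> / 2 * (1 - t) * (norm (w - x))\<^sup>2 + \<epsilon>)"
          by (simp add: a algebra_simps)
        then show ?case using elim(2) by simp
      qed
    qed simp
    then have "v \<bullet> (w - x) \<le> b - a - \<sigma> / 2 * (norm (w - x))\<^sup>2"
      by (rule field_le_epsilon)
    then show ?thesis by (simp add: a b)
  qed
  then show ?thesis using x by (simp add: strong_subgradients_def)
qed

text \<open>Minimality of \<open>z\<close> is compared with the points \<open>z + t *\<^sub>R (w - z)\<close>. The quadratic penalty contributes its
  derivative and a term of order \<open>t^2\<close>, which vanishes in the limit, whatever the sign of \<open>\<sigma> + 1 / g\<close>.\<close>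

lemma prox_strong_subgradient:
  fixes f :: "'a::real_inner \<Rightarrow> ereal"
  assumes f: "proper_fun f" "sigma_convex \<sigma> f" and g: "g > 0" and z: "z \<in> prox g f x"
  shows "(1 / g) *\<^sub>R (x - z) \<in> strong_subgradients \<sigma> f z"
proof -
  have min: "f z + ereal (1 / (2 * g) * (norm (z - x))\<^sup>2) \<le> f w + ereal (1 / (2 * g) * (norm (w - x))\<^sup>2)" for w
    using z by (auto simp: prox_def argmin_def is_arg_min_def not_less)
  obtain w0 where w0: "w0 \<in> edom f" using f(1) by (auto simp: proper_fun_def)
  have zd: "z \<in> edom f"
    using min[of w0] w0 by (auto simp: edom_def)
  then obtain a where a: "f z = ereal a" using edom_real f(1) by metis
  show ?thesis
  proof (rule strong_subgradient_from_directions[OF f zd])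
    fix w and \<epsilon> :: real assume e: "\<epsilon> > 0"
    define h where "h = w - z"
    have "\<forall>\<^sub>F t in at_right (0::real). 0 < t \<and> t < 2 * g * \<epsilon> / ((norm h)\<^sup>2 + 1)"
      unfolding eventually_at_right_field
      by (rule exI[of _ "2 * g * \<epsilon> / ((norm h)\<^sup>2 + 1)"]) (use g e in \<open>simp add: add_nonneg_pos\<close>)
    then show "\<forall>\<^sub>F t in at_right 0. f z + ereal (t * ((1 / g) *\<^sub>R (x - z) \<bullet> (w - z) - \<epsilon>)) \<le> f (z + t *\<^sub>R (w - z))"
    proof eventually_elim
      case (elim t)
      have n: "(norm (z + t *\<^sub>R h - x))\<^sup>2 = (norm (z - x))\<^sup>2 - 2 * t * ((x - z) \<bullet> h) + t\<^sup>2 * (norm h)\<^sup>2"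
        unfolding power2_norm_eq_inner power2_eq_square[of t]
        by (simp add: inner_diff_left inner_diff_right inner_add_left inner_add_right inner_commute algebra_simps)
      have "0 < (norm h)\<^sup>2 + 1" by (simp add: add_nonneg_pos)
      with elim have "t * ((norm h)\<^sup>2 + 1) \<le> 2 * g * \<epsilon>"
        by (simp add: pos_less_divide_eq)
      then have "t * (norm h)\<^sup>2 \<le> 2 * g * \<epsilon>" using elim by (simp add: algebra_simps)
      then have "t * (t * (norm h)\<^sup>2) \<le> t * (2 * g * \<epsilon>)" using elim by (intro mult_left_mono) auto
      then have e1: "1 / (2 * g) * (t\<^sup>2 * (norm h)\<^sup>2) \<le> t * \<epsilon>"
        using g by (simp add: field_simps power2_eq_square)
      show ?case
      proof (cases "f (z + t *\<^sub>R h)")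
        case (real b)
        have "a + 1 / (2 * g) * (norm (z - x))\<^sup>2 \<le> b + 1 / (2 * g) * (norm (z + t *\<^sub>R h - x))\<^sup>2"
          using min[of "z + t *\<^sub>R h"] by (simp add: a real)
        then have "a \<le> b - 1 / g * (t * ((x - z) \<bullet> h)) + 1 / (2 * g) * (t\<^sup>2 * (norm h)\<^sup>2)"
          unfolding n by (simp add: algebra_simps diff_divide_distrib add_divide_distrib)
        then have "a + t * ((1 / g) * ((x - z) \<bullet> h) - \<epsilon>) \<le> b"
          using e1 by (simp add: algebra_simps)
        then show ?thesis using real a by (simp add: h_def)
      next
        case MInf
        then show ?thesis using f(1) by (simp add: proper_fun_def)
      qed (simp add: h_def)
    qed
  qed
qed

text \<open>The liminf condition, restricted to the ray from \<open>x\<close> towards \<open>w\<close>, is the bound required by the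
  directional criterion.\<close>

lemma regular_subdiff_strong_subgradient:
  fixes f :: "'a::real_inner \<Rightarrow> ereal"
  assumes f: "proper_fun f" "sigma_convex \<sigma> f" and v: "v \<in> regular_subdiff f x"
  shows "v \<in> strong_subgradients \<sigma> f x"
proof -
  have xd: "x \<in> edom f" and lim: "0 \<le> Liminf (at x) (\<lambda>y. (f y - f x - ereal (v \<bullet> (y - x))) / ereal (norm (y - x)))"
    using v by (auto simp: regular_subdiff_def)
  obtain a where a: "f x = ereal a" using edom_real f(1) xd by metis
  show ?thesis
  proof (rule strong_subgradient_from_directions[OF f xd])
    fix w and \<epsilon> :: real assume e: "\<epsilon> > 0"
    show "\<forall>\<^sub>F t in at_right 0. f x + ereal (t * (v \<bullet> (w - x) - \<epsilon>)) \<le> f (x + t *\<^sub>R (w - x))"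
    proof (cases "w = x")
      case True
      have "\<forall>\<^sub>F t in at_right (0::real). 0 < t" by (auto simp: eventually_at_right_field intro!: exI[of _ 1])
      then show ?thesis
      proof eventually_elim
        case (elim t)
        show ?case using elim e True by (simp add: a)
      qed
    next
      case False
      define h where "h = w - x"
      have h: "norm h > 0" using False by (simp add: h_def)
      have pos: "\<forall>\<^sub>F t in at_right (0::real). 0 < t" by (auto simp: eventually_at_right_field intro!: exI[of _ 1])
      have "\<forall>\<^sub>F y in at x. ereal (- \<epsilon> / norm h) < (f y - f x - ereal (v \<bullet> (y - x))) / ereal (norm (y - x))"
        using lim h e unfolding le_Liminf_iff by simp
      moreover have "filterlim (\<lambda>t. x + t *\<^sub>R h) (at x) (at_right 0)"
        unfolding filterlim_at
      proof
        show "\<forall>\<^sub>F t in at_right 0. x + t *\<^sub>R h \<in> UNIV \<and> x + t *\<^sub>R h \<noteq> x"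
          using pos by eventually_elim (use h in auto)
        show "((\<lambda>t. x + t *\<^sub>R h) \<longlongrightarrow> x) (at_right 0)"
          by (auto intro!: tendsto_eq_intros)
      qed
      ultimately have "\<forall>\<^sub>F t in at_right 0. ereal (- \<epsilon> / norm h)
          < (f (x + t *\<^sub>R h) - f x - ereal (v \<bullet> (x + t *\<^sub>R h - x))) / ereal (norm (x + t *\<^sub>R h - x))"
        by (rule eventually_compose_filterlim)
      with pos show ?thesis
      proof eventually_elim
        case (elim t)
        show ?case
        proof (cases "f (x + t *\<^sub>R h)")
          case (real b)
          have "- \<epsilon> / norm h < (b - a - t * (v \<bullet> h)) / (t * norm h)"
            using elim h by (simp add: real a)
          then have "- \<epsilon> * t < b - a - t * (v \<bullet> h)"
            using elim h by (simp add: field_simps)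
          then show ?thesis using real by (simp add: a h_def algebra_simps)
        next
          case MInf
          then show ?thesis using f(1) by (simp add: proper_fun_def)
        qed (simp add: h_def)
      qed
    qed
  qed
qed

text \<open>The defining inequality of strong subgradients is closed under the limits that define the limiting
  subdifferential, since the function values converge too.\<close>

lemma subdiff_strong_subgradient:
  fixes f :: "'a::real_inner \<Rightarrow> ereal"
  assumes f: "proper_fun f" "sigma_convex \<sigma> f" and v: "v \<in> subdiff f x"
  shows "v \<in> strong_subgradients \<sigma> f x"
proof -
  obtain xs zs where xd: "x \<in> edom f" and xs: "xs \<longlonglongrightarrow> x" and fx: "(\<lambda>k. f (xs k)) \<longlonglongrightarrow> f x"
    and zs: "zs \<longlonglongrightarrow> v" and reg: "\<And>k. zs k \<in> regular_subdiff f (xs k)"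
    using v by (auto simp: subdiff_def)
  obtain a where a: "f x = ereal a" using edom_real f(1) xd by metis
  have "f x + ereal (v \<bullet> (w - x) + \<sigma> / 2 * (norm (w - x))\<^sup>2) \<le> f w" for w
  proof (rule LIMSEQ_le_const2)
    have "(\<lambda>k. ereal (zs k \<bullet> (w - xs k) + \<sigma> / 2 * (norm (w - xs k))\<^sup>2))
        \<longlonglongrightarrow> ereal (v \<bullet> (w - x) + \<sigma> / 2 * (norm (w - x))\<^sup>2)"
      by (intro tendsto_intros xs zs)
    with fx show "(\<lambda>k. f (xs k) + ereal (zs k \<bullet> (w - xs k) + \<sigma> / 2 * (norm (w - xs k))\<^sup>2))
        \<longlonglongrightarrow> f x + ereal (v \<bullet> (w - x) + \<sigma> / 2 * (norm (w - x))\<^sup>2)"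
      by (intro tendsto_add_ereal) (auto simp: a)
    show "\<exists>N. \<forall>n\<ge>N. f (xs n) + ereal (zs n \<bullet> (w - xs n) + \<sigma> / 2 * (norm (w - xs n))\<^sup>2) \<le> f w"
      using regular_subdiff_strong_subgradient[OF f reg] by (simp add: strong_subgradients_def)
  qed
  then show ?thesis using xd by (simp add: strong_subgradients_def)
qed

text \<open>The moduli add up as well, so a positive total modulus makes the minimizer of the sum unique even if
  single terms are nonconvex.\<close>

lemma sum_strong_subgradients:
  fixes f :: "'i \<Rightarrow> 'a::real_inner \<Rightarrow> ereal"
  assumes I: "finite I" and v: "\<And>i. i \<in> I \<Longrightarrow> v i \<in> strong_subgradients (\<sigma> i) (f i) x"
    and proper: "\<And>i. i \<in> I \<Longrightarrow> proper_fun (f i)"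
  shows "(\<Sum>i\<in>I. v i) \<in> strong_subgradients (\<Sum>i\<in>I. \<sigma> i) (\<lambda>u. \<Sum>i\<in>I. f i u) x"
proof -
  have "(\<Sum>i\<in>I. f i x) + ereal ((\<Sum>i\<in>I. v i) \<bullet> (w - x) + (\<Sum>i\<in>I. \<sigma> i) / 2 * (norm (w - x))\<^sup>2) \<le> (\<Sum>i\<in>I. f i w)" for w
  proof -
    have "(\<Sum>i\<in>I. f i x) + ereal ((\<Sum>i\<in>I. v i) \<bullet> (w - x) + (\<Sum>i\<in>I. \<sigma> i) / 2 * (norm (w - x))\<^sup>2)
       = (\<Sum>i\<in>I. f i x + ereal (v i \<bullet> (w - x) + \<sigma> i / 2 * (norm (w - x))\<^sup>2))"
      by (simp only: sum.distrib sum_ereal inner_sum_left sum_distrib_right sum_divide_distrib)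
    also have "\<dots> \<le> (\<Sum>i\<in>I. f i w)"
      using v by (intro sum_mono) (simp add: strong_subgradients_def)
    finally show ?thesis .
  qed
  moreover have "(\<Sum>i\<in>I. f i x) < \<infinity>"
    using v proper by (auto simp: strong_subgradients_def edom_def sum_Pinfty less_top[symmetric])
  ultimately show ?thesis by (simp add: strong_subgradients_def edom_def)
qed

lemma zero_strong_subgradient_argmin:
  assumes "0 \<in> strong_subgradients 0 f x"
  shows "x \<in> argmin f"
  using assms by (auto simp: strong_subgradients_def argmin_def is_arg_min_def not_less)

lemma zero_strong_subgradient_unique_argmin:
  fixes f :: "'a::real_inner \<Rightarrow> ereal"
  assumes x: "0 \<in> strong_subgradients \<sigma> f x" and f: "f x \<noteq> -\<infinity>" and s: "\<sigma> > 0"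
  shows "argmin f = {x}"
proof -
  obtain a where a: "f x = ereal a" using x f by (cases "f x") (auto simp: strong_subgradients_def edom_def)
  have less: "f x < f w" if "w \<noteq> x" for w
  proof -
    have "f x < f x + ereal (\<sigma> / 2 * (norm (w - x))\<^sup>2)"
      using that s by (simp add: a)
    also have "\<dots> \<le> f w" using x by (simp add: strong_subgradients_def)
    finally show ?thesis .
  qed
  then show ?thesis unfolding argmin_def is_arg_min_def
    by (auto dest: less_asym)
qed

section \<open>Existence of proximal points\<close>

text \<open>The punctured limit inferior in \<open>closed_fun\<close> says nothing about the point itself. This form of lower
  semicontinuity includes the point, and applies to sequences that hit their limit.\<close>

lemma closed_fun_eventually_gt:
  assumes f: "closed_fun f" and c: "c < f w"
  shows "\<forall>\<^sub>F u in nhds w. c < f u"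
proof -
  have "f w \<le> Liminf (at w) f" using f by (simp add: closed_fun_def)
  then have "\<forall>\<^sub>F u in at w. c < f u" using c unfolding le_Liminf_iff by blast
  then show ?thesis using c by (auto simp: eventually_at_filter elim: eventually_mono)
qed

text \<open>A minimizing sequence of the penalized function is Cauchy: by the parallelogram identity its midpoints
  would otherwise have values below the infimum. Lower semicontinuity identifies its limit as a
  minimizer. The minorant, of linear growth, keeps the infimum finite.\<close>

lemma prox_exists:
  fixes f :: "'a::{real_inner, complete_space} \<Rightarrow> ereal"
  assumes f: "proper_fun f" "closed_fun f" "sigma_convex 0 f"
    and minorant: "\<And>w. ereal (c - M * norm (w - u)) \<le> f w"
  shows "prox 1 f u \<noteq> {}"
proof -
  define g where "g w = f w + ereal (1 / 2 * (norm (w - u))\<^sup>2)" for w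
  define R where "R = {r. \<exists>w. g w \<le> ereal r}"
  define I where "I = Inf R"
  obtain w0 where "w0 \<in> edom f" using f(1) by (auto simp: proper_fun_def)
  then obtain a0 where "f w0 = ereal a0" using edom_real f(1) by metis
  then have "g w0 \<le> ereal (a0 + 1 / 2 * (norm (w0 - u))\<^sup>2)" by (simp add: g_def)
  then have R: "R \<noteq> {}" by (auto simp: R_def)
  have lower: "c - M\<^sup>2 / 2 \<le> r" if "r \<in> R" for r
  proof -
    obtain w where w: "g w \<le> ereal r" using \<open>r \<in> R\<close> by (auto simp: R_def)
    have "ereal (c - M * norm (w - u)) + ereal (1 / 2 * (norm (w - u))\<^sup>2) \<le> g w"
      unfolding g_def by (intro add_right_mono minorant)
    with w have "c - M * norm (w - u) + 1 / 2 * (norm (w - u))\<^sup>2 \<le> r"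
      by (metis ereal_less_eq(3) order_trans plus_ereal.simps(1))
    moreover have "0 \<le> (norm (w - u) - M)\<^sup>2" by simp
    ultimately show ?thesis by (simp add: power2_diff algebra_simps)
  qed
  then have bdd: "bdd_below R" by (auto simp: bdd_below_def)
  have I_le: "ereal I \<le> g w" for w
  proof (cases "g w")
    case (real r)
    then have "r \<in> R" unfolding R_def by (metis (mono_tags) mem_Collect_eq order_refl)
    then show ?thesis using bdd by (simp add: real I_def cInf_lower)
  next
    case MInf
    then show ?thesis using f(1) by (auto simp: g_def proper_fun_def)
  qed simp
  have "\<exists>w. g w \<le> ereal (I + 1 / real (Suc n))" for n
  proof -
    have "\<exists>r\<in>R. r < I + 1 / real (Suc n)"
      using cInf_lessD[OF R, of "I + 1 / real (Suc n)"] by (auto simp: I_def)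
    then obtain r w where "g w \<le> ereal r" "r < I + 1 / real (Suc n)" by (auto simp: R_def)
    then show ?thesis by (meson ereal_less_eq(3) less_imp_le order_trans)
  qed
  then obtain w where w: "\<And>n. g (w n) \<le> ereal (I + 1 / real (Suc n))" by metis
  have "\<exists>a. f (w n) = ereal a" for n
    using w[of n] f(1) by (cases "f (w n)") (auto simp: g_def proper_fun_def)
  then obtain a where a: "\<And>n. f (w n) = ereal (a n)" by metis
  \<comment> \<open>The midpoint of two almost minimizers gains an eighth of their squared distance.\<close>
  have gap: "(norm (w i - w j))\<^sup>2 \<le> 4 * (1 / real (Suc i) + 1 / real (Suc j))" for i j
  proof -
    define p where "p = w i + (1 / 2) *\<^sub>R (w j - w i)"
    have "f p \<le> ereal ((1 - 1 / 2) * a i + 1 / 2 * a j - 0 / 2 * (1 / 2) * (1 - 1 / 2) * (norm (w j - w i))\<^sup>2)"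
      unfolding p_def by (rule sigma_convex_segment[OF f(3)]) (auto simp: a)
    then have fp: "f p \<le> ereal (1 / 2 * a i + 1 / 2 * a j)" by simp
    have pu: "p - u = (1 / 2) *\<^sub>R ((w i - u) + (w j - u))"
    proof -
      have "2 *\<^sub>R (p - u) = (w i - u) + (w j - u)"
        by (simp add: p_def scaleR_right_diff_distrib scaleR_right_distrib scaleR_2)
      then have "(1 / 2) *\<^sub>R (2 *\<^sub>R (p - u)) = (1 / 2) *\<^sub>R ((w i - u) + (w j - u))" by simp
      then show ?thesis by simp
    qed
    have n: "(norm (p - u))\<^sup>2 = 1 / 2 * (norm (w i - u))\<^sup>2 + 1 / 2 * (norm (w j - u))\<^sup>2 - 1 / 4 * (norm (w i - w j))\<^sup>2"
    proof -
      have "(norm ((1 / 2) *\<^sub>R (b + d)))\<^sup>2 = 1 / 2 * (norm b)\<^sup>2 + 1 / 2 * (norm d)\<^sup>2 - 1 / 4 * (norm (b - d))\<^sup>2" for b d :: 'a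
        unfolding power2_norm_eq_inner
        by (simp add: inner_add_left inner_add_right inner_diff_left inner_diff_right inner_commute field_simps)
      from this[of "w i - u" "w j - u"] show ?thesis unfolding pu by simp
    qed
    have "ereal I \<le> f p + ereal (1 / 2 * (norm (p - u))\<^sup>2)" using I_le[of p] by (simp add: g_def)
    also have "\<dots> \<le> ereal (1 / 2 * a i + 1 / 2 * a j) + ereal (1 / 2 * (norm (p - u))\<^sup>2)"
      by (intro add_right_mono fp)
    finally have "I \<le> 1 / 2 * a i + 1 / 2 * a j + 1 / 2 * (norm (p - u))\<^sup>2" by simp
    moreover have "a n + 1 / 2 * (norm (w n - u))\<^sup>2 \<le> I + 1 / real (Suc n)" for n
      using w[of n] by (simp add: g_def a)
    from this[of i] this[of j]
    have "a i + 1 / 2 * (norm (w i - u))\<^sup>2 \<le> I + 1 / real (Suc i)"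
      "a j + 1 / 2 * (norm (w j - u))\<^sup>2 \<le> I + 1 / real (Suc j)" .
    ultimately show ?thesis unfolding n by argo
  qed
  have "Cauchy w"
  proof (rule CauchyI)
    fix e :: real assume e: "e > 0"
    then obtain N where N: "8 / e\<^sup>2 < real N" using reals_Archimedean2 by blast
    have "norm (w i - w j) < e" if "N \<le> i" "N \<le> j" for i j
    proof -
      have "1 / real (Suc i) \<le> 1 / real (Suc N)" "1 / real (Suc j) \<le> 1 / real (Suc N)"
        using that by (auto simp: field_simps)
      with gap[of i j] have "(norm (w i - w j))\<^sup>2 \<le> 8 / real (Suc N)" by simp
      also have "\<dots> < e\<^sup>2"
      proof -
        have "8 < real N * e\<^sup>2" using N e by (simp add: field_simps)
        also have "\<dots> \<le> real (Suc N) * e\<^sup>2" by (simp add: mult_right_mono)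
        finally show ?thesis by (simp add: field_simps)
      qed
      finally show ?thesis using e by (simp add: power2_less_imp_less)
    qed
    then show "\<exists>N. \<forall>i\<ge>N. \<forall>j\<ge>N. norm (w i - w j) < e" by blast
  qed
  then obtain z where z: "w \<longlonglongrightarrow> z" using Cauchy_convergent_iff convergent_def by blast
  have "f z \<le> ereal (I - 1 / 2 * (norm (z - u))\<^sup>2)"
  proof (rule dense_le)
    fix d assume "d < f z"
    then have "\<forall>\<^sub>F n in sequentially. d < f (w n)"
      using closed_fun_eventually_gt[OF f(2)] z filterlim_iff by blast
    then have ev: "\<forall>\<^sub>F n in sequentially. d \<le> ereal (I + 1 / real (Suc n) - 1 / 2 * (norm (w n - u))\<^sup>2)"
    proof eventually_elim
      case (elim n)
      have "f (w n) \<le> ereal (I + 1 / real (Suc n) - 1 / 2 * (norm (w n - u))\<^sup>2)"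
        using w[of n] by (simp add: g_def a)
      with elim show ?case by simp
    qed
    have "(\<lambda>n. 1 / real (Suc n)) \<longlonglongrightarrow> 0" by (rule LIMSEQ_Suc[OF lim_1_over_n])
    then have "(\<lambda>n. I + 1 / real (Suc n) - 1 / 2 * (norm (w n - u))\<^sup>2) \<longlonglongrightarrow> I + 0 - 1 / 2 * (norm (z - u))\<^sup>2"
      by (intro tendsto_intros z)
    then have "(\<lambda>n. ereal (I + 1 / real (Suc n) - 1 / 2 * (norm (w n - u))\<^sup>2)) \<longlonglongrightarrow> ereal (I - 1 / 2 * (norm (z - u))\<^sup>2)"
      by simp
    from tendsto_lowerbound[OF this ev] show "d \<le> ereal (I - 1 / 2 * (norm (z - u))\<^sup>2)" by simp
  qed
  then have "g z \<le> ereal I"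
    by (cases "f z") (auto simp: g_def)
  then have "g z \<le> g v" for v using I_le order_trans by blast
  then have "z \<in> prox 1 f u"
    by (auto simp: prox_def argmin_def is_arg_min_def g_def not_less)
  then show ?thesis by blast
qed

text \<open>The subdifferential of a closed convex function is maximally monotone, in the form of Minty: the
  identity plus the subdifferential is onto. The given subgradient supplies the minorant.\<close>

lemma resolvent_surjective:
  fixes f :: "'a::{real_inner, complete_space} \<Rightarrow> ereal"
  assumes f: "proper_fun f" "closed_fun f" "sigma_convex 0 f" and v: "v \<in> strong_subgradients 0 f x"
  shows "\<exists>w. u - w \<in> strong_subgradients 0 f w"
proof -
  obtain a where a: "f x = ereal a"
    using v edom_real f(1) by (metis (no_types, lifting) mem_Collect_eq strong_subgradients_def)
  have "ereal (a + v \<bullet> (u - x) - norm v * norm (w - u)) \<le> f w" for w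
  proof -
    have "v \<bullet> (w - x) = v \<bullet> (u - x) + v \<bullet> (w - u)" by (simp add: inner_diff_right)
    moreover have "- (norm v * norm (w - u)) \<le> v \<bullet> (w - u)"
      using Cauchy_Schwarz_ineq2[of v "w - u"] by linarith
    ultimately have "ereal (a + v \<bullet> (u - x) - norm v * norm (w - u)) \<le> f x + ereal (v \<bullet> (w - x))"
      by (simp add: a)
    also have "\<dots> \<le> f w" using v by (simp add: strong_subgradients_def)
    finally show ?thesis .
  qed
  then obtain w where "w \<in> prox 1 f u" using prox_exists[OF f] by blast
  then show ?thesis using prox_strong_subgradient[OF f(1,3), of 1] by auto
qed

text \<open>The representing vector is the proximal point of \<open>- \<phi>\<close> at the origin: there the first order condition
  says that \<open>\<phi> h \<le> z \<bullet> h\<close> for all \<open>h\<close>, and linearity gives equality.\<close>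

lemma riesz_representation:
  fixes \<phi> :: "'a::{real_inner, complete_space} \<Rightarrow> real"
  assumes lin: "linear \<phi>" and bound: "\<And>v. \<bar>\<phi> v\<bar> \<le> M * norm v"
  obtains l where "\<And>v. \<phi> v = l \<bullet> v"
proof -
  interpret linear \<phi> by (rule lin)
  define f where "f w = ereal (- \<phi> w)" for w
  have "bounded_linear \<phi>"
    by (rule bounded_linear_intro[of _ M]) (use bound in \<open>auto simp: add scale mult.commute\<close>)
  then have cont: "isCont \<phi> w" for w by (rule linear_continuous_at)
  have proper: "proper_fun f" by (auto simp: proper_fun_def edom_def f_def)
  have "closed_fun f"
    unfolding closed_fun_def le_Liminf_iff
  proof (intro allI impI)
    fix w d assume d: "d < f w"
    have "(f \<longlongrightarrow> f w) (at w)"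
      using cont[of w] unfolding f_def isCont_def by (auto intro: tendsto_intros)
    then show "\<forall>\<^sub>F u in at w. d < f u" using d by (rule order_tendstoD(1))
  qed
  moreover have conv: "sigma_convex 0 f"
    by (auto simp: sigma_convex_def convex_fun_def f_def add scale algebra_simps)
  moreover have "ereal (0 - M * norm (w - 0)) \<le> f w" for w
    using bound[of w] by (simp add: f_def)
  ultimately have "prox 1 f 0 \<noteq> {}" using prox_exists proper by blast
  then obtain z where z: "z \<in> prox 1 f 0" by blast
  have "(1 / 1) *\<^sub>R (0 - z) \<in> strong_subgradients 0 f z"
    by (rule prox_strong_subgradient[OF proper conv _ z]) simp
  then have le: "\<phi> (w - z) \<le> z \<bullet> (w - z)" for w
    by (auto simp: strong_subgradients_def f_def diff dest!: spec[of _ w])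
  have le': "\<phi> h \<le> z \<bullet> h" for h using le[of "z + h"] by simp
  have "\<phi> h = z \<bullet> h" for h using le'[of h] le'[of "- h"] by (simp add: neg)
  then show ?thesis using that by blast
qed

text \<open>The functionals \<open>v \<mapsto> u i k \<bullet> v\<close>, for all \<open>i\<close> at once, lie in a product of compact intervals. Tychonoff's
  theorem gives a cluster point in the product topology, and Riesz representation turns it into vectors.
  A finer filter takes the place of a subsequence, which avoids a diagonal extraction.\<close>

lemma weak_cluster_point:
  fixes u :: "'i \<Rightarrow> 'k \<Rightarrow> 'a::{real_inner, complete_space}"
  assumes F: "F \<noteq> bot" and bound: "\<And>i k. norm (u i k) \<le> M i"
  obtains G l where "G \<le> F" "G \<noteq> bot" "\<And>i v. ((\<lambda>k. u i k \<bullet> v) \<longlongrightarrow> l i \<bullet> v) G"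
proof -
  define P where "P k = (\<lambda>(i, v). u i k \<bullet> v)" for k
  define K :: "('i \<times> 'a \<Rightarrow> real) set" where "K = PiE UNIV (\<lambda>(i, v). {- (M i * norm v)..M i * norm v})"
  have "compactin (product_topology (\<lambda>_. euclidean) UNIV) K"
    unfolding K_def by (subst compactin_PiE) (auto simp: compactin_euclidean_iff)
  then have K: "compact K" by (simp add: euclidean_product_topology compactin_euclidean_iff)
  have PK: "P k \<in> K" for k
  proof -
    have "\<bar>u i k \<bullet> v\<bar> \<le> M i * norm v" for i v
      using Cauchy_Schwarz_ineq2[of "u i k" v] mult_right_mono[OF bound[of i k], of "norm v"] by simp
    then have "- (M i * norm v) \<le> u i k \<bullet> v \<and> u i k \<bullet> v \<le> M i * norm v" for i v
      by (metis abs_le_D1 abs_le_D2 minus_le_iff)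
    then have "P k j \<in> (case j of (i, v) \<Rightarrow> {- (M i * norm v)..M i * norm v})" for j
      by (cases j) (simp add: P_def)
    then show ?thesis unfolding K_def by (intro PiE_I) simp_all
  qed
  have "filtermap P F \<noteq> bot" using F by (simp add: filtermap_bot_iff)
  moreover have "\<forall>\<^sub>F h in filtermap P F. h \<in> K" by (simp add: eventually_filtermap PK)
  ultimately obtain \<phi> where \<phi>: "\<phi> \<in> K" and cluster: "inf (nhds \<phi>) (filtermap P F) \<noteq> bot"
    using K[unfolded compact_filter, rule_format, of "filtermap P F"] by blast
  define G where "G = inf (filtercomap P (nhds \<phi>)) F"
  have G: "G \<noteq> bot"
  proof
    assume "G = bot"
    then have "eventually (\<lambda>_. False) G" by simp
    then obtain Q R where Q: "eventually Q (filtercomap P (nhds \<phi>))" and R: "eventually R F"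
      and QR: "\<And>k. Q k \<Longrightarrow> R k \<Longrightarrow> False"
      unfolding G_def eventually_inf by blast
    obtain Q' where Q': "eventually Q' (nhds \<phi>)" "\<And>k. Q' (P k) \<Longrightarrow> Q k"
      using Q unfolding eventually_filtercomap by blast
    have "eventually (\<lambda>h. \<not> Q' h) (filtermap P F)"
      unfolding eventually_filtermap using R by eventually_elim (use QR Q' in blast)
    with Q'(1) have "eventually (\<lambda>_. False) (inf (nhds \<phi>) (filtermap P F))"
      unfolding eventually_inf by blast
    with cluster show False by (simp add: trivial_limit_def)
  qed
  have lim: "((\<lambda>k. u i k \<bullet> v) \<longlongrightarrow> \<phi> (i, v)) G" for i v
  proof -
    have "filterlim P (nhds \<phi>) G"
      using filterlim_filtercomap by (rule filterlim_mono) (auto simp: G_def)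
    moreover have "continuous_on UNIV (\<lambda>h::'i \<times> 'a \<Rightarrow> real. h (i, v))"
      by (rule continuous_on_product_coordinates)
    then have "((\<lambda>h::'i \<times> 'a \<Rightarrow> real. h (i, v)) \<longlongrightarrow> \<phi> (i, v)) (at \<phi>)"
      by (simp add: continuous_on_def)
    ultimately show ?thesis
      using tendsto_compose[of "\<lambda>h. h (i, v)" \<phi> P G] by (simp add: P_def)
  qed
  have "\<exists>l. \<forall>v. \<phi> (i, v) = l \<bullet> v" for i
  proof -
    have "linear (\<lambda>v. \<phi> (i, v))"
    proof (rule linearI)
      fix v w and r :: real
      show "\<phi> (i, v + w) = \<phi> (i, v) + \<phi> (i, w)"
        by (rule tendsto_unique[OF G lim]) (use tendsto_add[OF lim lim] in \<open>simp add: inner_add_right\<close>)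
      show "\<phi> (i, r *\<^sub>R v) = r *\<^sub>R \<phi> (i, v)"
        by (rule tendsto_unique[OF G lim]) (use tendsto_mult_left[OF lim] in simp)
    qed
    moreover have "\<bar>\<phi> (i, v)\<bar> \<le> M i * norm v" for v
    proof -
      have "\<phi> (i, v) \<in> {- (M i * norm v)..M i * norm v}"
        using \<phi> PiE_mem[of \<phi> UNIV _ "(i, v)"] unfolding K_def by fastforce
      then show ?thesis by auto
    qed
    ultimately show ?thesis using riesz_representation by metis
  qed
  then obtain l where l: "\<And>i v. \<phi> (i, v) = l i \<bullet> v" by metis
  show ?thesis
    by (rule that[of G l]) (use G lim l in \<open>auto simp: G_def\<close>)
qed

section \<open>Elementary estimates\<close>

text \<open>For \<open>2 * N \<le> k\<close>, the term \<open>k * a k\<close> is at most twice the block sum over \<open>{N..<k}\<close>, which has at least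
  \<open>k / 2\<close> terms, all at least \<open>a k\<close>.\<close>

lemma summable_decseq_times_index:
  fixes a :: "nat \<Rightarrow> real"
  assumes sum: "summable a" and dec: "decseq a" and nonneg: "\<And>k. 0 \<le> a k"
  shows "(\<lambda>k. real k * a k) \<longlonglongrightarrow> 0"
proof (rule LIMSEQ_I)
  fix e :: real assume e: "e > 0"
  then obtain N where N: "\<And>n k. N \<le> n \<Longrightarrow> norm (sum a {n..<k}) < e / 2"
    using sum unfolding summable_Cauchy by (metis half_gt_zero)
  have "norm (real k * a k - 0) < e" if k: "2 * N \<le> k" for k
  proof -
    have "real k * a k \<le> 2 * (real (k - N) * a k)"
    proof -
      have "real k \<le> 2 * real (k - N)" using k by simp
      from mult_right_mono[OF this nonneg[of k]] show ?thesis by simp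
    qed
    also have "real (k - N) * a k = (\<Sum>j\<in>{N..<k}. a k)" by simp
    also have "\<dots> \<le> sum a {N..<k}"
      using dec by (intro sum_mono) (auto simp: decseq_def)
    also have "\<dots> < e / 2" using N[of N k] by simp
    finally show ?thesis using nonneg[of k] by simp
  qed
  then show "\<exists>N. \<forall>k\<ge>N. norm (real k * a k - 0) < e" by blast
qed

lemma norm_sq_add_le: "(norm (a + b))\<^sup>2 \<le> 2 * (norm a)\<^sup>2 + 2 * (norm (b::'a::real_normed_vector))\<^sup>2"
proof -
  have "(norm (a + b))\<^sup>2 \<le> (norm a + norm b)\<^sup>2" by (simp add: norm_triangle_ineq power_mono)
  also have "\<dots> \<le> 2 * (norm a)\<^sup>2 + 2 * (norm b)\<^sup>2"
    using sum_squares_bound[of "norm a" "norm b"] by (simp add: power2_sum)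
  finally show ?thesis .
qed

lemma bounded_inner_tendsto_0:
  fixes a b :: "nat \<Rightarrow> 'a::real_inner"
  assumes a: "bounded (range a)" and b: "b \<longlonglongrightarrow> 0"
  shows "(\<lambda>k. a k \<bullet> b k) \<longlonglongrightarrow> 0"
proof -
  obtain C where C: "\<And>k. norm (a k) \<le> C" using a by (auto simp: bounded_iff)
  have "(\<lambda>k. C * norm (b k)) \<longlonglongrightarrow> 0" using tendsto_mult_left[OF tendsto_norm[OF b], of C] by simp
  then show ?thesis
  proof (rule Lim_null_comparison[rotated])
    have "norm (a k \<bullet> b k) \<le> C * norm (b k)" for k
      using Cauchy_Schwarz_ineq2[of "a k" "b k"] mult_right_mono[OF C[of k] norm_ge_zero[of "b k"]] by simp
    then show "\<forall>\<^sub>F k in sequentially. norm (a k \<bullet> b k) \<le> C * norm (b k)" by simp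
  qed
qed

text \<open>The map \<open>(e, q) \<mapsto> (e, s *\<^sub>R q - c *\<^sub>R e)\<close> is invertible for \<open>s > 0\<close>, so a form that controls its two
  components controls \<open>e\<close> and \<open>q\<close>.\<close>

lemma coercive_form:
  fixes \<alpha> \<beta> s c :: real
  assumes "\<alpha> > 0" "\<beta> > 0" "s > 0"
  obtains \<kappa> where "\<kappa> > 0"
    "\<And>e q::'a::real_normed_vector. \<kappa> * ((norm e)\<^sup>2 + (norm q)\<^sup>2) \<le> \<alpha> * (norm e)\<^sup>2 + \<beta> * (norm (s *\<^sub>R q - c *\<^sub>R e))\<^sup>2"
proof -
  define A B where "A = 1 + 2 * c\<^sup>2 / s\<^sup>2" and "B = 2 / s\<^sup>2"
  define K where "K = A / \<alpha> + B / \<beta>"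
  have pos: "A > 0" "B > 0" using assms by (auto simp: A_def B_def add_pos_nonneg)
  then have K: "K > 0" "A \<le> K * \<alpha>" "B \<le> K * \<beta>"
    using assms by (auto simp: K_def field_simps add_pos_pos)
  have "(norm e)\<^sup>2 + (norm q)\<^sup>2 \<le> K * (\<alpha> * (norm e)\<^sup>2 + \<beta> * (norm (s *\<^sub>R q - c *\<^sub>R e))\<^sup>2)" for e q :: 'a
  proof -
    have "s\<^sup>2 * (norm q)\<^sup>2 = (norm ((s *\<^sub>R q - c *\<^sub>R e) + c *\<^sub>R e))\<^sup>2" by (simp add: power_mult_distrib)
    also have "\<dots> \<le> 2 * (norm (s *\<^sub>R q - c *\<^sub>R e))\<^sup>2 + 2 * (c\<^sup>2 * (norm e)\<^sup>2)"
      using norm_sq_add_le[of "s *\<^sub>R q - c *\<^sub>R e" "c *\<^sub>R e"] by (simp add: power_mult_distrib)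
    finally have "(norm e)\<^sup>2 + (norm q)\<^sup>2 \<le> A * (norm e)\<^sup>2 + B * (norm (s *\<^sub>R q - c *\<^sub>R e))\<^sup>2"
      using assms by (simp add: A_def B_def field_simps)
    also have "\<dots> \<le> (K * \<alpha>) * (norm e)\<^sup>2 + (K * \<beta>) * (norm (s *\<^sub>R q - c *\<^sub>R e))\<^sup>2"
      using K by (intro add_mono mult_right_mono) auto
    finally show ?thesis by (simp add: algebra_simps)
  qed
  with K(1) show ?thesis
    by (intro that[of "1 / K"]) (auto simp: field_simps)
qed

section \<open>The energy inequality of a splitting step\<close>

text \<open>The functions enter only through operators \<open>A i\<close> that are \<open>\<sigma> i\<close>-monotone, possibly with a negative
  modulus.\<close>

locale splitting =
  fixes m :: nat and \<sigma> lam :: "nat \<Rightarrow> real" and \<mu> \<gamma> :: real and A :: "nat \<Rightarrow> 'a::real_inner \<Rightarrow> 'a set"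
  assumes m: "2 \<le> m" and mu: "0 < \<mu>" "\<mu> < 2" and gamma: "0 < \<gamma>"
    and lam: "\<And>i. i \<in> {1..<m} \<Longrightarrow> 0 < lam i" "(\<Sum>i\<in>{1..<m}. lam i) = 1"
    and monotone: "\<And>i u u' v v'. i \<in> {1..m} \<Longrightarrow> v \<in> A i u \<Longrightarrow> v' \<in> A i u' \<Longrightarrow>
      \<sigma> i * (norm (u - u'))\<^sup>2 \<le> (v - v') \<bullet> (u - u')"
begin

text \<open>One step of the algorithm, written as inclusions. It is a relation because resolvents of nonmonotone
  operators need not be single-valued.\<close>

definition resolved :: "(nat \<Rightarrow> 'a) \<Rightarrow> (nat \<Rightarrow> 'a) \<Rightarrow> 'a \<Rightarrow> bool" where
  "resolved X Z Y \<longleftrightarrow> (\<forall>i\<in>{1..<m}. (lam i / \<gamma>) *\<^sub>R (X i - Z i) \<in> A i (Z i)) \<and>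
     (1 / \<gamma>) *\<^sub>R ((\<Sum>i\<in>{1..<m}. lam i *\<^sub>R (2 *\<^sub>R Z i - X i)) - Y) \<in> A m Y"

definition energy :: "(nat \<Rightarrow> 'a) \<Rightarrow> real" where
  "energy X = (\<Sum>i\<in>{1..<m}. lam i * (norm (X i))\<^sup>2)"

definition dissipation :: "(nat \<Rightarrow> 'a) \<Rightarrow> 'a \<Rightarrow> real" where
  "dissipation p q = \<mu> * (2 - \<mu>) * energy (\<lambda>i. q - p i)
     + 2 * \<mu> * \<gamma> * ((\<Sum>i\<in>{1..<m}. \<sigma> i * (norm (p i))\<^sup>2) + \<sigma> m * (norm q)\<^sup>2)"

definition solution :: "'a \<Rightarrow> (nat \<Rightarrow> 'a) \<Rightarrow> bool" where
  "solution u v \<longleftrightarrow> (\<forall>i\<in>{1..m}. v i \<in> A i u) \<and> (\<Sum>i\<in>{1..m}. v i) = 0"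

text \<open>The value of \<open>x i\<close> that reproduces the zero \<open>u\<close>: the \<open>i\<close>-th resolvent inclusion then carries the element
  \<open>v i\<close> of \<open>A i u\<close>.\<close>

definition fixed_point :: "'a \<Rightarrow> (nat \<Rightarrow> 'a) \<Rightarrow> nat \<Rightarrow> 'a" where
  "fixed_point u v i = u + (\<gamma> / lam i) *\<^sub>R v i"

lemma sum_split_last: "(\<Sum>i\<in>{1..m}. h i) = (\<Sum>i\<in>{1..<m}. h i) + (h m :: 'b::comm_monoid_add)"
  using m sum.last_plus[of 1 m h] by (simp add: add.commute)

lemma energy_nonneg: "0 \<le> energy X"
  unfolding energy_def using lam(1) by (intro sum_nonneg mult_nonneg_nonneg) (auto intro: less_imp_le)

lemma energy_cong: "(\<And>i. i \<in> {1..<m} \<Longrightarrow> X i = X' i) \<Longrightarrow> energy X = energy X'"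
  by (simp add: energy_def)

lemma energy_component:
  assumes "i \<in> {1..<m}"
  shows "(norm (X i))\<^sup>2 \<le> energy X / lam i"
proof -
  have "lam i * (norm (X i))\<^sup>2 \<le> energy X"
    unfolding energy_def using lam(1)
    by (intro member_le_sum[OF assms, of "\<lambda>i. lam i * (norm (X i))\<^sup>2"]) (auto simp: less_imp_le)
  then show ?thesis using lam(1)[OF assms] by (simp add: field_simps)
qed

lemma energy_scaleR: "energy (\<lambda>i. c *\<^sub>R X i) = c\<^sup>2 * energy X"
  by (simp add: energy_def sum_distrib_left power_mult_distrib algebra_simps)

lemma fixed_point_resolved:
  assumes "solution u v"
  shows "resolved (fixed_point u v) (\<lambda>_. u) u"
proof -
  have s: "(\<Sum>i\<in>{1..<m}. v i) + v m = 0"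
    using assms unfolding solution_def sum_split_last by blast
  have "(\<Sum>i\<in>{1..<m}. lam i *\<^sub>R (2 *\<^sub>R u - fixed_point u v i)) = (\<Sum>i\<in>{1..<m}. lam i *\<^sub>R u - \<gamma> *\<^sub>R v i)"
    by (intro sum.cong) (use lam(1) in \<open>force simp: fixed_point_def algebra_simps scaleR_2\<close>)+
  also have "\<dots> = u - \<gamma> *\<^sub>R (\<Sum>i\<in>{1..<m}. v i)"
    unfolding sum_subtractf scaleR_left.sum[symmetric] scaleR_right.sum[symmetric] lam(2) by simp
  also have "\<dots> = u + \<gamma> *\<^sub>R v m" using s by (simp add: eq_neg_iff_add_eq_0[symmetric])
  finally have "(1 / \<gamma>) *\<^sub>R ((\<Sum>i\<in>{1..<m}. lam i *\<^sub>R (2 *\<^sub>R u - fixed_point u v i)) - u) = v m"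
    using gamma by simp
  moreover have "(lam i / \<gamma>) *\<^sub>R (fixed_point u v i - u) = v i" if "i \<in> {1..<m}" for i
    using lam(1)[OF that] gamma by (simp add: fixed_point_def)
  ultimately show ?thesis using assms m by (simp add: resolved_def solution_def)
qed

text \<open>Monotonicity is applied in each of the \<open>m\<close> inclusions, and the inequalities are added with the weights
  of the energy. In the inclusion at \<open>Y\<close> the weights sum to one, which distributes it over the other
  indices. What remains is, index by index, an expansion of the squared norm of \<open>d i + \<mu> *\<^sub>R e i\<close>.\<close>

lemma energy_decrease:
  assumes r: "resolved X Z Y" "resolved X' Z' Y'"
  shows "energy (\<lambda>i. (X i + \<mu> *\<^sub>R (Y - Z i)) - (X' i + \<mu> *\<^sub>R (Y' - Z' i)))
      + dissipation (\<lambda>i. Z i - Z' i) (Y - Y') \<le> energy (\<lambda>i. X i - X' i)"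
proof -
  define d p q e where "d i = X i - X' i" and "p i = Z i - Z' i" and "q = Y - Y'" and "e i = q - p i" for i
  have 1: "\<gamma> * (\<sigma> i * (norm (p i))\<^sup>2) \<le> lam i * ((d i - p i) \<bullet> p i)" if i: "i \<in> {1..<m}" for i
  proof -
    have "\<sigma> i * (norm (p i))\<^sup>2 \<le> ((lam i / \<gamma>) *\<^sub>R (X i - Z i) - (lam i / \<gamma>) *\<^sub>R (X' i - Z' i)) \<bullet> p i"
      unfolding p_def by (rule monotone) (use i r in \<open>auto simp: resolved_def\<close>)
    also have "\<dots> = (lam i / \<gamma>) * ((d i - p i) \<bullet> p i)"
      by (simp add: d_def p_def algebra_simps flip: scaleR_right_diff_distrib)
    finally show ?thesis using gamma by (simp add: field_simps)
  qed
  have 2: "\<gamma> * (\<sigma> m * (norm q)\<^sup>2) \<le> (\<Sum>i\<in>{1..<m}. lam i * ((2 *\<^sub>R p i - d i - q) \<bullet> q))"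
  proof -
    have "\<sigma> m * (norm q)\<^sup>2 \<le> ((1 / \<gamma>) *\<^sub>R ((\<Sum>i\<in>{1..<m}. lam i *\<^sub>R (2 *\<^sub>R Z i - X i)) - Y)
       - (1 / \<gamma>) *\<^sub>R ((\<Sum>i\<in>{1..<m}. lam i *\<^sub>R (2 *\<^sub>R Z' i - X' i)) - Y')) \<bullet> q"
      unfolding q_def by (rule monotone) (use m r in \<open>auto simp: resolved_def\<close>)
    also have "\<dots> = (1 / \<gamma>) * (((\<Sum>i\<in>{1..<m}. lam i *\<^sub>R (2 *\<^sub>R Z i - X i))
        - (\<Sum>i\<in>{1..<m}. lam i *\<^sub>R (2 *\<^sub>R Z' i - X' i)) - q) \<bullet> q)"
      by (simp add: q_def algebra_simps flip: scaleR_right_diff_distrib)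
    also have "(\<Sum>i\<in>{1..<m}. lam i *\<^sub>R (2 *\<^sub>R Z i - X i)) - (\<Sum>i\<in>{1..<m}. lam i *\<^sub>R (2 *\<^sub>R Z' i - X' i)) - q
       = (\<Sum>i\<in>{1..<m}. lam i *\<^sub>R (2 *\<^sub>R p i - d i - q))"
    proof -
      have "(\<Sum>i\<in>{1..<m}. lam i *\<^sub>R q) = q"
        unfolding scaleR_left.sum[symmetric] lam(2) by simp
      moreover have "(\<Sum>i\<in>{1..<m}. lam i *\<^sub>R (2 *\<^sub>R p i - d i - q))
          = (\<Sum>i\<in>{1..<m}. lam i *\<^sub>R (2 *\<^sub>R Z i - X i) - lam i *\<^sub>R (2 *\<^sub>R Z' i - X' i) - lam i *\<^sub>R q)"
        by (intro sum.cong) (simp_all add: p_def d_def algebra_simps)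
      ultimately show ?thesis by (simp add: sum_subtractf)
    qed
    also have "\<dots> \<bullet> q = (\<Sum>i\<in>{1..<m}. lam i * ((2 *\<^sub>R p i - d i - q) \<bullet> q))"
      by (simp only: inner_sum_left inner_scaleR_left)
    finally show ?thesis using gamma by (simp add: pos_le_divide_eq mult.commute)
  qed
  have "(norm (d i + \<mu> *\<^sub>R e i))\<^sup>2 + \<mu> * (2 - \<mu>) * (norm (e i))\<^sup>2
      = (norm (d i))\<^sup>2 - 2 * \<mu> * ((d i - p i) \<bullet> p i + (2 *\<^sub>R p i - d i - q) \<bullet> q)" for i
    unfolding power2_norm_eq_inner e_def
    by (simp add: inner_add_left inner_add_right inner_diff_left inner_diff_right inner_commute power2_eq_square algebra_simps)
  then have "lam i * (norm (d i + \<mu> *\<^sub>R e i))\<^sup>2 + \<mu> * (2 - \<mu>) * (lam i * (norm (e i))\<^sup>2)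
      = lam i * (norm (d i))\<^sup>2 - 2 * \<mu> * (lam i * ((d i - p i) \<bullet> p i) + lam i * ((2 *\<^sub>R p i - d i - q) \<bullet> q))" for i
    by (metis (no_types, opaque_lifting) distrib_left mult.left_commute right_diff_distrib)
  then have 3: "energy (\<lambda>i. d i + \<mu> *\<^sub>R e i) + \<mu> * (2 - \<mu>) * energy e = energy d
      - 2 * \<mu> * ((\<Sum>i\<in>{1..<m}. lam i * ((d i - p i) \<bullet> p i)) + (\<Sum>i\<in>{1..<m}. lam i * ((2 *\<^sub>R p i - d i - q) \<bullet> q)))"
    unfolding energy_def sum_distrib_left sum.distrib[symmetric] sum_subtractf[symmetric]
    by (simp add: sum_distrib_left sum_subtractf flip: sum.distrib)
  have "\<gamma> * (\<Sum>i\<in>{1..<m}. \<sigma> i * (norm (p i))\<^sup>2) + \<gamma> * (\<sigma> m * (norm q)\<^sup>2)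
     \<le> (\<Sum>i\<in>{1..<m}. lam i * ((d i - p i) \<bullet> p i)) + (\<Sum>i\<in>{1..<m}. lam i * ((2 *\<^sub>R p i - d i - q) \<bullet> q))"
    unfolding sum_distrib_left by (intro add_mono sum_mono 1 2)
  then have "2 * \<mu> * (\<gamma> * (\<Sum>i\<in>{1..<m}. \<sigma> i * (norm (p i))\<^sup>2) + \<gamma> * (\<sigma> m * (norm q)\<^sup>2))
     \<le> 2 * \<mu> * ((\<Sum>i\<in>{1..<m}. lam i * ((d i - p i) \<bullet> p i)) + (\<Sum>i\<in>{1..<m}. lam i * ((2 *\<^sub>R p i - d i - q) \<bullet> q)))"
    using mu by (intro mult_left_mono) auto
  with 3 have "energy (\<lambda>i. d i + \<mu> *\<^sub>R e i) + dissipation p q \<le> energy d"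
    unfolding dissipation_def e_def[symmetric, abs_def] by (simp add: algebra_simps)
  moreover have "(\<lambda>i. d i + \<mu> *\<^sub>R e i) = (\<lambda>i. (X i + \<mu> *\<^sub>R (Y - Z i)) - (X' i + \<mu> *\<^sub>R (Y' - Z' i)))"
    by (simp add: d_def e_def p_def q_def fun_eq_iff algebra_simps)
  ultimately show ?thesis by (simp add: d_def[abs_def] p_def[abs_def] q_def)
qed

section \<open>Lower bounds for the dissipation\<close>

text \<open>The modulus \<open>\<sigma> m\<close> belongs to the common variable \<open>q\<close> and can be shared among the indices. After a
  split \<open>\<tau>\<close>, the dissipation is a sum of forms in \<open>(e, q) = (q - p i, q)\<close>. Each has to control its own
  residual, and a single index has to control \<open>q\<close>.\<close>

lemma dissipation_margin:
  fixes \<tau> \<kappa> :: "nat \<Rightarrow> real"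
  assumes \<tau>: "(\<Sum>i\<in>{1..<m}. \<tau> i) = \<sigma> m"
    and pos: "\<And>i. i \<in> {1..<m} \<Longrightarrow> 0 < \<kappa> i"
    and each: "\<And>i e q::'a. i \<in> {1..<m} \<Longrightarrow>
      \<kappa> i * (norm e)\<^sup>2 \<le> \<mu> * (2 - \<mu>) * lam i * (norm e)\<^sup>2 + 2 * \<mu> * \<gamma> * (\<sigma> i * (norm (q - e))\<^sup>2 + \<tau> i * (norm q)\<^sup>2)"
    and j: "j \<in> {1..<m}"
    and some: "\<And>e q::'a.
      \<kappa> j * ((norm e)\<^sup>2 + (norm q)\<^sup>2) \<le> \<mu> * (2 - \<mu>) * lam j * (norm e)\<^sup>2 + 2 * \<mu> * \<gamma> * (\<sigma> j * (norm (q - e))\<^sup>2 + \<tau> j * (norm q)\<^sup>2)"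
  obtains \<kappa>' where "\<kappa>' > 0" "\<And>p q. \<kappa>' * (energy (\<lambda>i. q - p i) + (norm q)\<^sup>2) \<le> dissipation p q"
proof -
  define \<kappa>' where "\<kappa>' = Min (\<kappa> ` {1..<m})"
  have ne: "\<kappa> ` {1..<m} \<noteq> {}" using m by auto
  have k: "\<kappa>' > 0" using pos ne by (auto simp: \<kappa>'_def)
  have le: "\<kappa>' \<le> \<kappa> i" if "i \<in> {1..<m}" for i using that by (auto simp: \<kappa>'_def)
  have "\<kappa>' * (energy (\<lambda>i. q - p i) + (norm q)\<^sup>2) \<le> dissipation p q" for p q
  proof -
    define T where "T i = \<mu> * (2 - \<mu>) * lam i * (norm (q - p i))\<^sup>2 + 2 * \<mu> * \<gamma> * (\<sigma> i * (norm (p i))\<^sup>2 + \<tau> i * (norm q)\<^sup>2)" for i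
    have T1: "\<kappa>' * (norm (q - p i))\<^sup>2 \<le> T i" if "i \<in> {1..<m}" for i
      using mult_right_mono[OF le[OF that], of "(norm (q - p i))\<^sup>2"] each[OF that, of "q - p i" q] by (simp add: T_def)
    have T2: "\<kappa>' * ((norm (q - p j))\<^sup>2 + (norm q)\<^sup>2) \<le> T j"
      using mult_right_mono[OF le[OF j], of "(norm (q - p j))\<^sup>2 + (norm q)\<^sup>2"] some[of "q - p j" q] by (simp add: T_def)
    have lam1: "lam i \<le> 1" if "i \<in> {1..<m}" for i
      using member_le_sum[of i "{1..<m}" lam] that lam by (auto intro: less_imp_le)
    have "\<kappa>' * energy (\<lambda>i. q - p i) \<le> \<kappa>' * (\<Sum>i\<in>{1..<m}. (norm (q - p i))\<^sup>2)"
      unfolding energy_def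
      using k lam1 lam(1) by (intro mult_left_mono sum_mono mult_left_le_one_le) (auto intro: less_imp_le)
    also have "\<dots> = \<kappa>' * (norm (q - p j))\<^sup>2 + (\<Sum>i\<in>{1..<m} - {j}. \<kappa>' * (norm (q - p i))\<^sup>2)"
      using j by (simp add: sum.remove[of _ j] distrib_left flip: sum_distrib_left)
    finally have "\<kappa>' * (energy (\<lambda>i. q - p i) + (norm q)\<^sup>2)
        \<le> \<kappa>' * ((norm (q - p j))\<^sup>2 + (norm q)\<^sup>2) + (\<Sum>i\<in>{1..<m} - {j}. \<kappa>' * (norm (q - p i))\<^sup>2)"
      by (simp add: algebra_simps)
    also have "\<dots> \<le> T j + (\<Sum>i\<in>{1..<m} - {j}. T i)"
      by (intro add_mono T2 sum_mono T1) auto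
    also have "\<dots> = (\<Sum>i\<in>{1..<m}. T i)" using j by (simp add: sum.remove)
    also have "\<dots> = \<mu> * (2 - \<mu>) * (\<Sum>i\<in>{1..<m}. lam i * (norm (q - p i))\<^sup>2)
        + 2 * \<mu> * \<gamma> * ((\<Sum>i\<in>{1..<m}. \<sigma> i * (norm (p i))\<^sup>2) + (\<Sum>i\<in>{1..<m}. \<tau> i) * (norm q)\<^sup>2)"
      by (simp add: T_def sum.distrib sum_distrib_left sum_distrib_right mult.assoc distrib_left)
    also have "\<dots> = dissipation p q" unfolding dissipation_def energy_def \<tau> by simp
    finally show ?thesis .
  qed
  with k show ?thesis using that by blast
qed

text \<open>With nonnegative moduli, \<open>\<sigma> m\<close> can be given to the first index. If \<open>j < m\<close>, then \<open>p j = q - e\<close> is controlled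
  by the \<open>j\<close>-th form; if \<open>j = m\<close>, then \<open>q\<close> is controlled directly by the first one. The coefficient \<open>c\<close>
  tells these two apart.\<close>

lemma dissipation_margin_convex:
  assumes nonneg: "\<And>i. i \<in> {1..m} \<Longrightarrow> 0 \<le> \<sigma> i" and j: "j \<in> {1..m}" "\<sigma> j > 0"
  obtains \<kappa>' where "\<kappa>' > 0" "\<And>p q. \<kappa>' * (energy (\<lambda>i. q - p i) + (norm q)\<^sup>2) \<le> dissipation p q"
proof -
  define j' where "j' = (if j = m then 1 else j)"
  define c :: real where "c = (if j = m then 0 else 1)"
  define \<tau> where "\<tau> i = (if i = 1 then \<sigma> m else 0)" for i :: nat
  have j': "j' \<in> {1..<m}" using j m by (auto simp: j'_def)
  have b: "\<mu> * (2 - \<mu>) * lam i > 0" if "i \<in> {1..<m}" for i using that mu lam(1) by simp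
  obtain \<kappa>0 where k0: "\<kappa>0 > 0" "\<And>e q::'a. \<kappa>0 * ((norm e)\<^sup>2 + (norm q)\<^sup>2)
     \<le> \<mu> * (2 - \<mu>) * lam j' * (norm e)\<^sup>2 + 2 * \<mu> * \<gamma> * \<sigma> j * (norm (1 *\<^sub>R q - c *\<^sub>R e))\<^sup>2"
    using coercive_form[of "\<mu> * (2 - \<mu>) * lam j'" "2 * \<mu> * \<gamma> * \<sigma> j" 1 c] b[OF j'] mu gamma j(2) by auto
  have \<tau>: "0 \<le> \<tau> i" for i using nonneg[of m] m by (simp add: \<tau>_def)
  have nn: "0 \<le> \<sigma> i * (norm (q - e))\<^sup>2 + \<tau> i * (norm q)\<^sup>2" if "i \<in> {1..<m}" for i and e q :: 'a
    using nonneg[of i] that \<tau>[of i] by simp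
  show ?thesis
  proof (rule dissipation_margin[of \<tau> "\<lambda>i. if i = j' then \<kappa>0 else \<mu> * (2 - \<mu>) * lam i" j'])
    show "(\<Sum>i\<in>{1..<m}. \<tau> i) = \<sigma> m" unfolding \<tau>_def using m by simp
    have some: "\<kappa>0 * ((norm e)\<^sup>2 + (norm q)\<^sup>2)
       \<le> \<mu> * (2 - \<mu>) * lam j' * (norm e)\<^sup>2 + 2 * \<mu> * \<gamma> * (\<sigma> j' * (norm (q - e))\<^sup>2 + \<tau> j' * (norm q)\<^sup>2)" for e q :: 'a
    proof -
      have "\<sigma> j * (norm (1 *\<^sub>R q - c *\<^sub>R e))\<^sup>2 \<le> \<sigma> j' * (norm (q - e))\<^sup>2 + \<tau> j' * (norm q)\<^sup>2"
        using nonneg[of 1] m \<tau>[of j] by (auto simp: j'_def c_def \<tau>_def)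
      then have "2 * \<mu> * \<gamma> * (\<sigma> j * (norm (1 *\<^sub>R q - c *\<^sub>R e))\<^sup>2) \<le> 2 * \<mu> * \<gamma> * (\<sigma> j' * (norm (q - e))\<^sup>2 + \<tau> j' * (norm q)\<^sup>2)"
        using mu gamma by (intro mult_left_mono) auto
      with k0(2)[of e q] show ?thesis by (simp add: mult.assoc)
    qed
    then show "(if j' = j' then \<kappa>0 else \<mu> * (2 - \<mu>) * lam j') * ((norm e)\<^sup>2 + (norm q)\<^sup>2)
       \<le> \<mu> * (2 - \<mu>) * lam j' * (norm e)\<^sup>2 + 2 * \<mu> * \<gamma> * (\<sigma> j' * (norm (q - e))\<^sup>2 + \<tau> j' * (norm q)\<^sup>2)" for e q :: 'a
      by simp
    show "(if i = j' then \<kappa>0 else \<mu> * (2 - \<mu>) * lam i) * (norm e)\<^sup>2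
       \<le> \<mu> * (2 - \<mu>) * lam i * (norm e)\<^sup>2 + 2 * \<mu> * \<gamma> * (\<sigma> i * (norm (q - e))\<^sup>2 + \<tau> i * (norm q)\<^sup>2)"
      if i: "i \<in> {1..<m}" for i and e q :: 'a
    proof (cases "i = j'")
      case True
      have "\<kappa>0 * (norm e)\<^sup>2 \<le> \<kappa>0 * ((norm e)\<^sup>2 + (norm q)\<^sup>2)" using k0(1) by simp
      with some[of e q] True show ?thesis by simp
    next
      case False
      with nn[OF i, of q e] mu gamma show ?thesis by simp
    qed
  qed (use j' k0(1) b that in auto)
qed

text \<open>The split is \<open>\<tau> i = \<sigma> m * \<delta> i\<close>. Completing the square leaves the coefficient of the constraint on
  the residual. At the step size \<open>\<gamma>\<close> this coefficient is a convex combination of \<open>1 - \<mu> / 2 > 0\<close> and of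
  its nonnegative value at \<open>lbar\<close>, with positive weight on the former because \<open>\<gamma> < lbar\<close>. The
  components of \<open>\<delta>\<close> sum to one, so some index carries a full square, and this square controls \<open>q\<close>.\<close>

lemma dissipation_margin_feasible:
  assumes feas: "P_feasible m \<sigma> \<mu> lam \<delta> lbar" and less: "\<gamma> < lbar"
  obtains \<kappa>' where "\<kappa>' > 0" "\<And>p q. \<kappa>' * (energy (\<lambda>i. q - p i) + (norm q)\<^sup>2) \<le> dissipation p q"
proof -
  define I where "I = index_set m \<sigma>"
  have I: "I \<subseteq> {1..<m}" "finite I" by (auto simp: I_def index_set_def)
  have sumI: "(\<Sum>i\<in>I. \<delta> i) = 1" using feas by (simp add: P_feasible_def I_def)
  then have "I \<noteq> {}" by auto
  then obtain j where j: "j \<in> I" by blast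
  define \<tau> where "\<tau> i = (if i \<in> I then \<sigma> m * \<delta> i else 0)" for i
  define s where "s i = \<sigma> i + \<sigma> m * \<delta> i" for i
  have s: "s i > 0" and con: "1 + lbar / lam i * (\<sigma> i * \<sigma> m * \<delta> i / s i) - \<mu> / 2 \<ge> 0" if "i \<in> I" for i
  proof -
    have "s i \<ge> 0" "if s i = 0 then lbar = 0 else 1 + lbar / lam i * (\<sigma> i * \<sigma> m * \<delta> i / s i) - \<mu> / 2 \<ge> 0"
      using feas that by (auto simp: P_feasible_def I_def s_def)
    then show "s i > 0" "1 + lbar / lam i * (\<sigma> i * \<sigma> m * \<delta> i / s i) - \<mu> / 2 \<ge> 0"
      using less gamma by (auto split: if_splits)
  qed
  have "\<exists>\<kappa>>0. \<forall>e q::'a. \<kappa> * ((norm e)\<^sup>2 + (norm q)\<^sup>2)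
      \<le> \<mu> * (2 - \<mu>) * lam i * (norm e)\<^sup>2 + 2 * \<mu> * \<gamma> * (\<sigma> i * (norm (q - e))\<^sup>2 + \<tau> i * (norm q)\<^sup>2)"
    if i: "i \<in> I" for i
  proof -
    define c where "c = \<sigma> i * \<tau> i / s i"
    define \<alpha> where "\<alpha> = 2 * \<mu> * lam i * (1 - \<mu> / 2 + \<gamma> / lam i * c)"
    have li: "lam i > 0" using i I lam(1) by blast
    have "1 - \<mu> / 2 + \<gamma> / lam i * c = (1 - \<gamma> / lbar) * (1 - \<mu> / 2) + \<gamma> / lbar * (1 + lbar / lam i * c - \<mu> / 2)"
      using less gamma li by (simp add: field_simps)
    also have "\<dots> > 0"
      using con[OF i] i less gamma mu
      by (intro add_pos_nonneg mult_pos_pos mult_nonneg_nonneg) (auto simp: c_def \<tau>_def mult.assoc)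
    finally have \<alpha>: "\<alpha> > 0" using mu li by (simp add: \<alpha>_def)
    have \<beta>: "2 * \<mu> * \<gamma> / s i > 0" using mu gamma s[OF i] by simp
    have quad: "\<sigma> i * (norm (q - e))\<^sup>2 + \<tau> i * (norm q)\<^sup>2
        = c * (norm e)\<^sup>2 + 1 / s i * (norm (s i *\<^sub>R q - \<sigma> i *\<^sub>R e))\<^sup>2" for e q :: 'a
    proof -
      have "s i * (\<sigma> i * (norm (q - e))\<^sup>2 + \<tau> i * (norm q)\<^sup>2) = \<sigma> i * \<tau> i * (norm e)\<^sup>2 + (norm (s i *\<^sub>R q - \<sigma> i *\<^sub>R e))\<^sup>2"
        using i unfolding power2_norm_eq_inner s_def \<tau>_def
        by (simp add: inner_diff_left inner_diff_right inner_commute algebra_simps)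
      then show ?thesis using s[OF i] by (simp add: c_def field_simps)
    qed
    obtain \<kappa> where k: "\<kappa> > 0" "\<And>e q::'a. \<kappa> * ((norm e)\<^sup>2 + (norm q)\<^sup>2)
        \<le> \<alpha> * (norm e)\<^sup>2 + 2 * \<mu> * \<gamma> / s i * (norm (s i *\<^sub>R q - \<sigma> i *\<^sub>R e))\<^sup>2"
      using coercive_form[OF \<alpha> \<beta> s[OF i], of "\<sigma> i"] by blast
    have "\<alpha> * (norm e)\<^sup>2 + 2 * \<mu> * \<gamma> / s i * (norm (s i *\<^sub>R q - \<sigma> i *\<^sub>R e))\<^sup>2
       = \<mu> * (2 - \<mu>) * lam i * (norm e)\<^sup>2 + 2 * \<mu> * \<gamma> * (\<sigma> i * (norm (q - e))\<^sup>2 + \<tau> i * (norm q)\<^sup>2)" for e q :: 'a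
      unfolding quad \<alpha>_def using li by (simp add: field_simps)
    with k show ?thesis by (intro exI[of _ \<kappa>]) auto
  qed
  then obtain \<kappa> where k: "\<And>i. i \<in> I \<Longrightarrow> \<kappa> i > 0"
    "\<And>i e q::'a. i \<in> I \<Longrightarrow> \<kappa> i * ((norm e)\<^sup>2 + (norm q)\<^sup>2)
      \<le> \<mu> * (2 - \<mu>) * lam i * (norm e)\<^sup>2 + 2 * \<mu> * \<gamma> * (\<sigma> i * (norm (q - e))\<^sup>2 + \<tau> i * (norm q)\<^sup>2)"
    by metis
  show ?thesis
  proof (rule dissipation_margin[of \<tau> "\<lambda>i. if i \<in> I then \<kappa> i else \<mu> * (2 - \<mu>) * lam i" j])
    have "(\<Sum>i\<in>{1..<m}. \<tau> i) = (\<Sum>i\<in>I. \<tau> i)"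
      by (rule sum.mono_neutral_right) (use I in \<open>auto simp: \<tau>_def\<close>)
    also have "\<dots> = \<sigma> m * (\<Sum>i\<in>I. \<delta> i)" by (simp add: \<tau>_def sum_distrib_left)
    finally show "(\<Sum>i\<in>{1..<m}. \<tau> i) = \<sigma> m" using sumI by simp
    show "(if j \<in> I then \<kappa> j else \<mu> * (2 - \<mu>) * lam j) * ((norm e)\<^sup>2 + (norm q)\<^sup>2)
       \<le> \<mu> * (2 - \<mu>) * lam j * (norm e)\<^sup>2 + 2 * \<mu> * \<gamma> * (\<sigma> j * (norm (q - e))\<^sup>2 + \<tau> j * (norm q)\<^sup>2)" for e q :: 'a
      using k(2)[OF j] j by simp
    show "(if i \<in> I then \<kappa> i else \<mu> * (2 - \<mu>) * lam i) * (norm e)\<^sup>2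
       \<le> \<mu> * (2 - \<mu>) * lam i * (norm e)\<^sup>2 + 2 * \<mu> * \<gamma> * (\<sigma> i * (norm (q - e))\<^sup>2 + \<tau> i * (norm q)\<^sup>2)"
      if i: "i \<in> {1..<m}" for i and e q :: 'a
    proof (cases "i \<in> I")
      case True
      have "\<kappa> i * (norm e)\<^sup>2 \<le> \<kappa> i * ((norm e)\<^sup>2 + (norm q)\<^sup>2)" using k(1)[OF True] by simp
      with k(2)[OF True, of e q] True show ?thesis by simp
    next
      case False
      then have "\<sigma> i = 0" using i by (auto simp: I_def index_set_def)
      with False show ?thesis by (simp add: \<tau>_def)
    qed
    show "0 < (if i \<in> I then \<kappa> i else \<mu> * (2 - \<mu>) * lam i)" if "i \<in> {1..<m}" for i
      using k(1) mu lam(1)[OF that] by simp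
  qed (use j I that in auto)
qed

end

section \<open>Residuals and rates\<close>

locale splitting_iteration = splitting m \<sigma> lam \<mu> \<gamma> A
  for m \<sigma> lam \<mu> \<gamma> and A :: "nat \<Rightarrow> 'a::real_inner \<Rightarrow> 'a set" +
  fixes x z :: "nat \<Rightarrow> nat \<Rightarrow> 'a" and y :: "nat \<Rightarrow> 'a"
  assumes step: "\<And>k. resolved (\<lambda>i. x i k) (\<lambda>i. z i k) (y k)"
    and x_step: "\<And>i k. i \<in> {1..<m} \<Longrightarrow> x i (Suc k) = x i k + \<mu> *\<^sub>R (y k - z i k)"
begin

text \<open>The weighted squared residuals. Up to the factor \<open>\<mu>^2\<close> this is the energy of the increment of \<open>x\<close>.\<close>

definition gap :: "nat \<Rightarrow> real" where
  "gap k = energy (\<lambda>i. y k - z i k)"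

lemma energy_increment: "energy (\<lambda>i. x i (Suc k) - x i k) = \<mu>\<^sup>2 * gap k"
  unfolding gap_def energy_scaleR[symmetric] by (rule energy_cong) (simp add: x_step)

lemma fejer_step:
  assumes "solution u v"
  shows "energy (\<lambda>i. x i (Suc k) - fixed_point u v i) + dissipation (\<lambda>i. z i k - u) (y k - u)
    \<le> energy (\<lambda>i. x i k - fixed_point u v i)"
proof -
  have "energy (\<lambda>i. x i (Suc k) - fixed_point u v i)
      = energy (\<lambda>i. (x i k + \<mu> *\<^sub>R (y k - z i k)) - (fixed_point u v i + \<mu> *\<^sub>R (u - u)))"
    by (rule energy_cong) (simp add: x_step)
  with energy_decrease[OF step fixed_point_resolved[OF assms], of k] show ?thesis by simp
qed

text \<open>The iteration compared with its own shift by one.\<close>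

lemma increment_step:
  "\<mu>\<^sup>2 * gap (Suc k) + dissipation (\<lambda>i. z i (Suc k) - z i k) (y (Suc k) - y k) \<le> \<mu>\<^sup>2 * gap k"
proof -
  have "energy (\<lambda>i. x i (Suc (Suc k)) - x i (Suc k))
      = energy (\<lambda>i. (x i (Suc k) + \<mu> *\<^sub>R (y (Suc k) - z i (Suc k))) - (x i k + \<mu> *\<^sub>R (y k - z i k)))"
    by (rule energy_cong) (simp add: x_step)
  with energy_decrease[OF step step, of "Suc k" k] show ?thesis by (simp flip: energy_increment)
qed

text \<open>Sequences of this kind are closed under sums and inherit the rate of the residuals, so that a rate
  follows from a mere quadratic estimate.\<close>

definition gap_bounded :: "(nat \<Rightarrow> 'a) \<Rightarrow> bool" where
  "gap_bounded w \<longleftrightarrow> (\<exists>C. \<forall>k. (norm (w k))\<^sup>2 \<le> C * gap k)"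

lemma gap_nonneg: "0 \<le> gap k"
  by (simp add: gap_def energy_nonneg)

lemma gap_bounded_add:
  assumes "gap_bounded a" "gap_bounded b"
  shows "gap_bounded (\<lambda>k. a k + b k)"
proof -
  obtain C D where "\<And>k. (norm (a k))\<^sup>2 \<le> C * gap k" "\<And>k. (norm (b k))\<^sup>2 \<le> D * gap k"
    using assms by (auto simp: gap_bounded_def)
  then have "(norm (a k + b k))\<^sup>2 \<le> (2 * C + 2 * D) * gap k" for k
    using norm_sq_add_le[of "a k" "b k"] by (smt (verit) distrib_right mult.assoc)
  then show ?thesis by (auto simp: gap_bounded_def)
qed

lemma gap_bounded_minus: "gap_bounded a \<Longrightarrow> gap_bounded (\<lambda>k. - a k)"
  by (simp add: gap_bounded_def)

lemma gap_bounded_diff: "gap_bounded a \<Longrightarrow> gap_bounded b \<Longrightarrow> gap_bounded (\<lambda>k. a k - b k)"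
  using gap_bounded_add[of a "\<lambda>k. - b k"] gap_bounded_minus[of b] by simp

lemma gap_bounded_residual: "i \<in> {1..<m} \<Longrightarrow> gap_bounded (\<lambda>k. y k - z i k)"
  using energy_component[of i "\<lambda>i. y k - z i k" for k]
  by (auto simp: gap_bounded_def gap_def intro!: exI[of _ "1 / lam i"])

lemma gap_bounded_increment:
  assumes "i \<in> {1..<m}"
  shows "gap_bounded (\<lambda>k. x i (Suc k) - x i k)"
  unfolding gap_bounded_def
proof (intro exI allI)
  fix k
  show "(norm (x i (Suc k) - x i k))\<^sup>2 \<le> \<mu>\<^sup>2 / lam i * gap k"
    using energy_component[OF assms, of "\<lambda>i. x i (Suc k) - x i k"] by (simp add: energy_increment)
qed

end

text \<open>All that the general part of the convergence analysis requires is a dissipation that dominates the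
  residuals, and one zero \<open>u0\<close> of the sum of the operators.\<close>

locale dissipative_iteration = splitting_iteration +
  fixes \<kappa> u0 v0
  assumes kappa: "\<kappa> > 0" and dissipative: "\<And>p q. \<kappa> * energy (\<lambda>i. q - p i) \<le> dissipation p q"
    and solution: "solution u0 v0"
begin

lemma dissipation_nonneg: "0 \<le> dissipation p q"
  using dissipative[of q p] kappa energy_nonneg[of "\<lambda>i. q - p i"] by (meson mult_nonneg_nonneg less_imp_le order_trans)

lemma gap_decseq: "decseq gap"
proof (rule decseq_SucI)
  fix k
  have "\<mu>\<^sup>2 * gap (Suc k) \<le> \<mu>\<^sup>2 * gap k" using increment_step[of k] dissipation_nonneg by (smt (verit))
  then show "gap (Suc k) \<le> gap k" using mu by simp
qed

lemma energy_decseq: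
  assumes "solution u v"
  shows "decseq (\<lambda>k. energy (\<lambda>i. x i k - fixed_point u v i))"
  using fejer_step[OF assms] dissipation_nonneg by (intro decseq_SucI) (smt (verit))

lemma energy_convergent:
  assumes "solution u v"
  shows "convergent (\<lambda>k. energy (\<lambda>i. x i k - fixed_point u v i))"
  using decseq_convergent[OF energy_decseq[OF assms], of 0] energy_nonneg unfolding convergent_def by metis

lemma dissipation_tendsto_0: "(\<lambda>k. dissipation (\<lambda>i. z i k - u0) (y k - u0)) \<longlonglongrightarrow> 0"
  and summable_gap: "summable gap"
proof -
  define \<Phi> where "\<Phi> k = energy (\<lambda>i. x i k - fixed_point u0 v0 i)" for k
  define d where "d k = dissipation (\<lambda>i. z i k - u0) (y k - u0)" for k
  have d: "0 \<le> d k" "d k \<le> \<Phi> k - \<Phi> (Suc k)" for k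
    using dissipation_nonneg fejer_step[OF solution, of k] by (auto simp: d_def \<Phi>_def)
  obtain L where "\<Phi> \<longlonglongrightarrow> L" using energy_convergent[OF solution] unfolding \<Phi>_def convergent_def by blast
  then have "summable (\<lambda>k. \<Phi> k - \<Phi> (Suc k))" by (rule telescope_summable')
  then have sum: "summable d"
    by (rule summable_comparison_test') (use d in simp)
  then have "d \<longlonglongrightarrow> 0" by (rule summable_LIMSEQ_zero)
  then show "(\<lambda>k. dissipation (\<lambda>i. z i k - u0) (y k - u0)) \<longlonglongrightarrow> 0" by (simp add: d_def[abs_def])
  have "norm (gap k) \<le> d k / \<kappa>" for k
    using dissipative[of "y k - u0" "\<lambda>i. z i k - u0"] kappa gap_nonneg[of k]
    by (simp add: d_def gap_def field_simps)
  then show "summable gap"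
    by (intro summable_comparison_test'[OF summable_divide[OF sum]]) auto
qed

text \<open>The gap decreases and is summable, hence it is \<open>o(1/k)\<close>; the rate is its square root.\<close>

lemma gap_bounded_rate:
  assumes "gap_bounded w"
  shows "(\<lambda>k. norm (w k)) \<in> o(\<lambda>k. 1 / sqrt (real k))"
proof (rule smalloI_tendsto)
  obtain C where C: "\<And>k. (norm (w k))\<^sup>2 \<le> C * gap k" using assms by (auto simp: gap_bounded_def)
  have "(\<lambda>k. real k * gap k) \<longlonglongrightarrow> 0"
    by (rule summable_decseq_times_index[OF summable_gap gap_decseq gap_nonneg])
  from tendsto_real_sqrt[OF tendsto_mult_left[OF this, of C]]
  have "(\<lambda>k. sqrt (C * (real k * gap k))) \<longlonglongrightarrow> 0" by simp
  then have "(\<lambda>k. norm (w k) * sqrt (real k)) \<longlonglongrightarrow> 0"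
  proof (rule Lim_null_comparison[rotated])
    have "norm (norm (w k) * sqrt (real k)) \<le> sqrt (C * (real k * gap k))" for k
    proof (rule real_le_rsqrt)
      show "(norm (norm (w k) * sqrt (real k)))\<^sup>2 \<le> C * (real k * gap k)"
        using mult_left_mono[OF C[of k], of "real k"] by (simp add: power_mult_distrib mult_ac)
    qed
    then show "\<forall>\<^sub>F k in sequentially. norm (norm (w k) * sqrt (real k)) \<le> sqrt (C * (real k * gap k))" by simp
  qed
  then show "(\<lambda>k. norm (w k) / (1 / sqrt (real k))) \<longlonglongrightarrow> 0" by simp
  show "\<forall>\<^sub>F k in sequentially. 1 / sqrt (real k) \<noteq> 0"
    using eventually_gt_at_top[of 0] by eventually_elim simp
qed

lemma gap_bounded_tendsto_0:
  assumes "gap_bounded w"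
  shows "w \<longlonglongrightarrow> 0"
proof -
  obtain C where C: "\<And>k. (norm (w k))\<^sup>2 \<le> C * gap k" using assms by (auto simp: gap_bounded_def)
  have "(\<lambda>k. C * gap k) \<longlonglongrightarrow> 0"
    using summable_LIMSEQ_zero[OF summable_gap] by (auto intro!: tendsto_eq_intros)
  then have "(\<lambda>k. (norm (w k))\<^sup>2) \<longlonglongrightarrow> 0"
    by (rule Lim_null_comparison[rotated]) (use C in simp)
  then have "(\<lambda>k. sqrt ((norm (w k))\<^sup>2)) \<longlonglongrightarrow> sqrt 0" by (rule tendsto_real_sqrt)
  then show ?thesis by (simp add: tendsto_norm_zero_iff)
qed

lemma gap_bounded_residual_change:
  assumes "i \<in> {1..<m}"
  shows "gap_bounded (\<lambda>k. y (Suc k) - z i (Suc k))"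
proof -
  obtain C where C: "\<And>k. (norm (y k - z i k))\<^sup>2 \<le> C * gap k"
    using gap_bounded_residual[OF assms] by (auto simp: gap_bounded_def)
  have "(norm (y (Suc k) - z i (Suc k)))\<^sup>2 \<le> \<bar>C\<bar> * gap k" for k
  proof -
    have "(norm (y (Suc k) - z i (Suc k)))\<^sup>2 \<le> C * gap (Suc k)" by (rule C)
    also have "\<dots> \<le> \<bar>C\<bar> * gap k"
      using gap_decseq gap_nonneg by (intro mult_mono) (auto simp: decseq_Suc_iff)
    finally show ?thesis .
  qed
  then show ?thesis by (auto simp: gap_bounded_def)
qed

text \<open>The increments of \<open>y\<close> and of \<open>z i\<close> differ by two residuals.\<close>

lemma gap_bounded_difference_iff:
  assumes i: "i \<in> {1..<m}"
  shows "gap_bounded (\<lambda>k. z i (Suc k) - z i k) \<longleftrightarrow> gap_bounded (\<lambda>k. y (Suc k) - y k)"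
proof -
  note e = gap_bounded_residual[OF i] gap_bounded_residual_change[OF i]
  have r: "gap_bounded (\<lambda>k. (y (Suc k) - z i (Suc k)) - (y k - z i k))"
    by (rule gap_bounded_diff[OF e(2,1)])
  show ?thesis
  proof
    assume "gap_bounded (\<lambda>k. z i (Suc k) - z i k)"
    from gap_bounded_add[OF this r] show "gap_bounded (\<lambda>k. y (Suc k) - y k)" by (simp add: algebra_simps)
  next
    assume "gap_bounded (\<lambda>k. y (Suc k) - y k)"
    from gap_bounded_diff[OF this r] show "gap_bounded (\<lambda>k. z i (Suc k) - z i k)" by (simp add: algebra_simps)
  qed
qed

lemma bounded_x:
  assumes i: "i \<in> {1..<m}"
  shows "bounded (range (x i))"
proof -
  define \<Phi> where "\<Phi> k = energy (\<lambda>i. x i k - fixed_point u0 v0 i)" for k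
  have "norm (x i k) \<le> norm (fixed_point u0 v0 i) + sqrt (\<Phi> 0 / lam i)" for k
  proof -
    have "(norm (x i k - fixed_point u0 v0 i))\<^sup>2 \<le> \<Phi> k / lam i"
      unfolding \<Phi>_def by (rule energy_component[OF i])
    also have "\<dots> \<le> \<Phi> 0 / lam i"
      using energy_decseq[OF solution] lam(1)[OF i] by (intro divide_right_mono) (auto simp: \<Phi>_def decseq_def)
    finally have "norm (x i k - fixed_point u0 v0 i) \<le> sqrt (\<Phi> 0 / lam i)" by (rule real_le_rsqrt)
    then show ?thesis using norm_triangle_ineq[of "x i k - fixed_point u0 v0 i" "fixed_point u0 v0 i"] by simp
  qed
  then show ?thesis by (auto simp: bounded_iff)
qed

lemma residual_tendsto_0: "i \<in> {1..<m} \<Longrightarrow> (\<lambda>k. y k - z i k) \<longlonglongrightarrow> 0"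
  by (rule gap_bounded_tendsto_0[OF gap_bounded_residual])

lemma bounded_residual: "i \<in> {1..<m} \<Longrightarrow> bounded (range (\<lambda>k. y k - z i k))"
  using residual_tendsto_0 convergent_imp_bounded by blast

lemma bounded_z_iff:
  assumes i: "i \<in> {1..<m}"
  shows "bounded (range (z i)) \<longleftrightarrow> bounded (range y)"
proof
  assume "bounded (range (z i))"
  from bounded_minus_comp[OF bounded_residual[OF i] bounded_minus_comp[OF bounded_minus_comp[OF this this] this]]
  show "bounded (range y)" by simp
next
  assume "bounded (range y)"
  from bounded_minus_comp[OF this bounded_residual[OF i]] show "bounded (range (z i))" by simp
qed

section \<open>Strong convergence\<close>

text \<open>If the dissipation also dominates \<open>|q|^2\<close>, its summability relative to \<open>u0\<close> forces \<open>y\<close> to \<open>u0\<close>, and the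
  comparison of successive steps bounds the increments of \<open>y\<close> by the gap.\<close>

theorem strong_convergence:
  assumes coercive: "\<And>p q. \<kappa> * (norm q)\<^sup>2 \<le> dissipation p q"
  shows "y \<longlonglongrightarrow> u0" "\<And>i. i \<in> {1..<m} \<Longrightarrow> z i \<longlonglongrightarrow> u0"
    "gap_bounded (\<lambda>k. y (Suc k) - y k)" "bounded (range y)"
proof -
  define d where "d k = dissipation (\<lambda>i. z i k - u0) (y k - u0)" for k
  have "(\<lambda>k. sqrt (d k / \<kappa>)) \<longlonglongrightarrow> sqrt (0 / \<kappa>)"
    unfolding d_def by (intro tendsto_intros dissipation_tendsto_0) (use kappa in simp)
  then have lim: "(\<lambda>k. sqrt (d k / \<kappa>)) \<longlonglongrightarrow> 0" by simp
  have le: "norm (y k - u0) \<le> sqrt (d k / \<kappa>)" for k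
    using coercive[of "y k - u0" "\<lambda>i. z i k - u0"] kappa by (intro real_le_rsqrt) (simp add: d_def field_simps)
  have "(\<lambda>k. y k - u0) \<longlonglongrightarrow> 0" by (rule Lim_null_comparison[OF _ lim]) (simp add: le)
  then show y: "y \<longlonglongrightarrow> u0" by (simp add: LIM_zero_iff)
  then show "bounded (range y)" by (rule convergent_imp_bounded)
  show "z i \<longlonglongrightarrow> u0" if "i \<in> {1..<m}" for i
    using tendsto_diff[OF y residual_tendsto_0[OF that]] by simp
  have "(norm (y (Suc k) - y k))\<^sup>2 \<le> \<mu>\<^sup>2 / \<kappa> * gap k" for k
  proof -
    have "0 \<le> \<mu>\<^sup>2 * gap (Suc k)" by (simp add: gap_nonneg)
    then have "\<kappa> * (norm (y (Suc k) - y k))\<^sup>2 \<le> \<mu>\<^sup>2 * gap k"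
      using coercive[of "y (Suc k) - y k" "\<lambda>i. z i (Suc k) - z i k"] increment_step[of k] by linarith
    then show ?thesis using kappa by (simp add: field_simps)
  qed
  then show "gap_bounded (\<lambda>k. y (Suc k) - y k)" unfolding gap_bounded_def by (intro exI allI)
qed

end

section \<open>Weak convergence\<close>

text \<open>Maximal monotonicity is assumed through the surjectivity of the identity plus \<open>A i\<close>.\<close>

locale monotone_iteration = dissipative_iteration m \<sigma> lam \<mu> \<gamma> A x z y \<kappa> u0 v0
  for m \<sigma> lam \<mu> \<gamma> and A :: "nat \<Rightarrow> 'a::{real_inner, complete_space} \<Rightarrow> 'a set"
    and x z y \<kappa> u0 v0 +
  assumes flat: "\<And>i. i \<in> {1..m} \<Longrightarrow> \<sigma> i = 0"
    and maximal: "\<And>i u. i \<in> {1..m} \<Longrightarrow> \<exists>w. u - w \<in> A i w"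
begin

lemma resolvent_nonexpansive:
  assumes i: "i \<in> {1..<m}" and r: "resolved X Z Y" "resolved X' Z' Y'"
  shows "norm (Z i - Z' i) \<le> norm (X i - X' i)"
proof -
  have "\<sigma> i * (norm (Z i - Z' i))\<^sup>2
      \<le> ((lam i / \<gamma>) *\<^sub>R (X i - Z i) - (lam i / \<gamma>) *\<^sub>R (X' i - Z' i)) \<bullet> (Z i - Z' i)"
    by (rule monotone) (use i r in \<open>auto simp: resolved_def\<close>)
  also have "\<dots> = (lam i / \<gamma>) * ((X i - X' i) \<bullet> (Z i - Z' i) - (norm (Z i - Z' i))\<^sup>2)"
    unfolding power2_norm_eq_inner by (simp add: inner_diff_left algebra_simps)
  finally have "0 \<le> (lam i / \<gamma>) * ((X i - X' i) \<bullet> (Z i - Z' i) - (norm (Z i - Z' i))\<^sup>2)"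
    using flat[of i] i by simp
  moreover have "0 < lam i / \<gamma>" using lam(1)[OF i] gamma by simp
  ultimately have "0 \<le> (X i - X' i) \<bullet> (Z i - Z' i) - (norm (Z i - Z' i))\<^sup>2"
    by (meson mult_pos_neg not_le)
  then have "(norm (Z i - Z' i))\<^sup>2 \<le> (X i - X' i) \<bullet> (Z i - Z' i)" by simp
  also have "\<dots> \<le> norm (X i - X' i) * norm (Z i - Z' i)" by (rule norm_cauchy_schwarz)
  finally have "norm (Z i - Z' i) * norm (Z i - Z' i) \<le> norm (X i - X' i) * norm (Z i - Z' i)"
    by (simp add: power2_eq_square)
  then show ?thesis
    by (cases "Z i = Z' i") (auto simp: mult_le_cancel_right)
qed

lemma bounded_z:
  assumes i: "i \<in> {1..<m}"
  shows "bounded (range (z i))"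
proof -
  obtain C where C: "\<And>k. norm (x i k) \<le> C" using bounded_x[OF i] by (auto simp: bounded_iff)
  have "norm (z i k) \<le> C + norm (fixed_point u0 v0 i) + norm u0" for k
  proof -
    have "norm (z i k - u0) \<le> norm (x i k - fixed_point u0 v0 i)"
      using resolvent_nonexpansive[OF i step fixed_point_resolved[OF solution]] .
    also have "\<dots> \<le> C + norm (fixed_point u0 v0 i)"
      using norm_triangle_ineq4[of "x i k" "fixed_point u0 v0 i"] C[of k] by linarith
    finally show ?thesis using norm_triangle_ineq[of "z i k - u0" u0] by simp
  qed
  then show ?thesis by (auto simp: bounded_iff)
qed

lemma bounded_y: "bounded (range y)"
  using bounded_z_iff[of 1] bounded_z[of 1] m by auto

lemma gap_bounded_z:
  assumes i: "i \<in> {1..<m}"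
  shows "gap_bounded (\<lambda>k. z i (Suc k) - z i k)"
proof -
  obtain C where C: "\<And>k. (norm (x i (Suc k) - x i k))\<^sup>2 \<le> C * gap k"
    using gap_bounded_increment[OF i] by (auto simp: gap_bounded_def)
  have "(norm (z i (Suc k) - z i k))\<^sup>2 \<le> C * gap k" for k
    using power_mono[OF resolvent_nonexpansive[OF i step step, of "Suc k" k] norm_ge_zero, of 2] C[of k]
    by linarith
  then show ?thesis unfolding gap_bounded_def by (intro exI allI)
qed

lemma gap_bounded_y: "gap_bounded (\<lambda>k. y (Suc k) - y k)"
  using gap_bounded_difference_iff[of 1] gap_bounded_z[of 1] m by simp

text \<open>Let \<open>S i k\<close> be the elements of \<open>A i (Z i k)\<close> that the step provides. Their sum tends to zero strongly
  and the points \<open>Z i k\<close> merge, so the products \<open>S i k \<bullet> Z i k\<close> add up to a null sequence although each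
  factor converges only weakly. The summed monotonicity inequality therefore passes to the limit
  for any test pairs \<open>(w i, t i)\<close>. Choosing the resolvent points \<open>w i + t i = yb + a i\<close> turns the limit
  into minus a sum of squares, which must vanish, so \<open>w i = yb\<close> and \<open>t i = a i\<close>.\<close>

lemma cluster_point_solution:
  assumes G: "G \<le> sequentially" "G \<noteq> bot"
    and ylim: "\<And>v. ((\<lambda>k. y k \<bullet> v) \<longlongrightarrow> yb \<bullet> v) G"
    and xlim: "\<And>i v. i \<in> {1..<m} \<Longrightarrow> ((\<lambda>k. x i k \<bullet> v) \<longlongrightarrow> xb i \<bullet> v) G"
  obtains a where "solution yb a" "\<And>i. i \<in> {1..<m} \<Longrightarrow> fixed_point yb a i = xb i"
proof -
  define Z where "Z i k = (if i = m then y k else z i k)" for i k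
  define E where "E i k = y k - Z i k" for i k
  define S where "S i k = (if i = m then (1 / \<gamma>) *\<^sub>R ((\<Sum>i\<in>{1..<m}. lam i *\<^sub>R (2 *\<^sub>R z i k - x i k)) - y k)
     else (lam i / \<gamma>) *\<^sub>R (x i k - z i k))" for i k
  define r where "r k = (\<Sum>i\<in>{1..m}. S i k)" for k
  define a where "a i = (if i = m then - (\<Sum>i\<in>{1..<m}. (lam i / \<gamma>) *\<^sub>R (xb i - yb)) else (lam i / \<gamma>) *\<^sub>R (xb i - yb))" for i
  have S: "S i k \<in> A i (Z i k)" if "i \<in> {1..m}" for i k
    using step[of k] that by (auto simp: S_def Z_def resolved_def)
  have suma: "(\<Sum>i\<in>{1..m}. a i) = 0"
    unfolding sum_split_last by (simp add: a_def)
  have E0: "E i \<longlonglongrightarrow> 0" if "i \<in> {1..m}" for i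
    using residual_tendsto_0[of i] that by (cases "i = m") (auto simp: E_def[abs_def] Z_def)
  have r_eq: "r k = (- 1 / \<gamma>) *\<^sub>R (\<Sum>i\<in>{1..<m}. lam i *\<^sub>R E i k)" for k
  proof -
    have "(\<Sum>i\<in>{1..<m}. S i k) = (1 / \<gamma>) *\<^sub>R (\<Sum>i\<in>{1..<m}. lam i *\<^sub>R (x i k - z i k))"
      unfolding scaleR_right.sum by (intro sum.cong) (auto simp: S_def)
    then have "r k = (1 / \<gamma>) *\<^sub>R ((\<Sum>i\<in>{1..<m}. lam i *\<^sub>R (x i k - z i k))
        + (\<Sum>i\<in>{1..<m}. lam i *\<^sub>R (2 *\<^sub>R z i k - x i k)) - y k)"
      unfolding r_def sum_split_last by (simp add: S_def algebra_simps)
    also have "(\<Sum>i\<in>{1..<m}. lam i *\<^sub>R (x i k - z i k)) + (\<Sum>i\<in>{1..<m}. lam i *\<^sub>R (2 *\<^sub>R z i k - x i k))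
        = (\<Sum>i\<in>{1..<m}. lam i *\<^sub>R z i k)"
      unfolding sum.distrib[symmetric] by (intro sum.cong) (simp_all add: algebra_simps scaleR_2)
    also have "(\<Sum>i\<in>{1..<m}. lam i *\<^sub>R z i k) - y k = - (\<Sum>i\<in>{1..<m}. lam i *\<^sub>R E i k)"
    proof -
      have "(\<Sum>i\<in>{1..<m}. lam i *\<^sub>R E i k) = (\<Sum>i\<in>{1..<m}. lam i *\<^sub>R y k) - (\<Sum>i\<in>{1..<m}. lam i *\<^sub>R z i k)"
        unfolding sum_subtractf[symmetric] by (intro sum.cong) (auto simp: E_def Z_def scaleR_right_diff_distrib)
      then show ?thesis unfolding scaleR_left.sum[symmetric] lam(2) by simp
    qed
    finally show ?thesis by simp
  qed
  have "(\<lambda>k. (- 1 / \<gamma>) *\<^sub>R (\<Sum>i\<in>{1..<m}. lam i *\<^sub>R E i k)) \<longlonglongrightarrow> (- 1 / \<gamma>) *\<^sub>R (\<Sum>i\<in>{1..<m}. lam i *\<^sub>R 0)"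
    by (intro tendsto_intros E0) auto
  then have r0: "r \<longlonglongrightarrow> 0" by (simp add: r_eq[abs_def])
  have "\<And>i. \<exists>w. i \<in> {1..m} \<longrightarrow> (yb + a i) - w \<in> A i w" using maximal by blast
  then obtain w where w: "\<And>i. i \<in> {1..m} \<Longrightarrow> (yb + a i) - w i \<in> A i (w i)" by metis
  define t where "t i = (yb + a i) - w i" for i
  define h where "h k = (\<Sum>i\<in>{1..m}. (S i k - t i) \<bullet> (Z i k - w i))" for k
  have h_nonneg: "0 \<le> h k" for k
    unfolding h_def
  proof (rule sum_nonneg)
    fix i assume i: "i \<in> {1..m}"
    have "\<sigma> i * (norm (Z i k - w i))\<^sup>2 \<le> (S i k - t i) \<bullet> (Z i k - w i)"
      by (rule monotone[OF i S[OF i]]) (use w[OF i] in \<open>simp add: t_def\<close>)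
    then show "0 \<le> (S i k - t i) \<bullet> (Z i k - w i)" using flat[OF i] by simp
  qed
  have seqG: "(q \<longlongrightarrow> l) G" if "q \<longlonglongrightarrow> l" for q :: "nat \<Rightarrow> real" and l
    using that G(1) by (rule tendsto_mono[rotated])
  have Zlim: "((\<lambda>k. Z i k \<bullet> v) \<longlongrightarrow> yb \<bullet> v) G" if "i \<in> {1..m}" for i v
  proof -
    have "(\<lambda>k. E i k \<bullet> v) \<longlonglongrightarrow> 0 \<bullet> v" by (intro tendsto_intros E0 that)
    from tendsto_diff[OF ylim seqG[OF this], of v] show ?thesis by (simp add: E_def inner_diff_left)
  qed
  have Slim': "((\<lambda>k. S i k \<bullet> v) \<longlongrightarrow> a i \<bullet> v) G" if i: "i \<in> {1..<m}" for i v
  proof -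
    have "((\<lambda>k. (lam i / \<gamma>) * (x i k \<bullet> v - Z i k \<bullet> v)) \<longlongrightarrow> (lam i / \<gamma>) * (xb i \<bullet> v - yb \<bullet> v)) G"
      by (intro tendsto_intros xlim Zlim) (use i in auto)
    then show ?thesis using i by (simp add: S_def a_def Z_def inner_diff_left)
  qed
  have Slim: "((\<lambda>k. S i k \<bullet> v) \<longlongrightarrow> a i \<bullet> v) G" if i: "i \<in> {1..m}" for i v
  proof (cases "i = m")
    case True
    have "((\<lambda>k. r k \<bullet> v - (\<Sum>i\<in>{1..<m}. S i k \<bullet> v)) \<longlongrightarrow> 0 - (\<Sum>i\<in>{1..<m}. a i \<bullet> v)) G"
      by (intro tendsto_intros Slim' seqG) (use tendsto_inner[OF r0 tendsto_const, of v] in simp_all)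
    moreover have "r k \<bullet> v - (\<Sum>i\<in>{1..<m}. S i k \<bullet> v) = S m k \<bullet> v" for k
      unfolding r_def sum_split_last by (simp add: inner_add_left inner_sum_left)
    moreover have "0 - (\<Sum>i\<in>{1..<m}. a i \<bullet> v) = a m \<bullet> v"
      by (simp add: a_def inner_sum_left)
    ultimately show ?thesis using True by simp
  next
    case False
    then show ?thesis using Slim' i by simp
  qed
  have Sbd: "bounded (range (S i))" if "i \<in> {1..<m}" for i
  proof -
    have "bounded ((\<lambda>u. (lam i / \<gamma>) *\<^sub>R u) ` range (\<lambda>k. x i k - z i k))"
      by (intro bounded_scaling bounded_minus_comp bounded_x bounded_z that)
    then show ?thesis using that by (simp add: S_def[abs_def] image_image)
  qed
  have cross: "(\<lambda>k. \<Sum>i\<in>{1..m}. S i k \<bullet> Z i k) \<longlonglongrightarrow> 0"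
  proof -
    have "(\<lambda>k. y k \<bullet> r k - (\<Sum>i\<in>{1..<m}. S i k \<bullet> E i k)) \<longlonglongrightarrow> 0 - (\<Sum>i\<in>{1..<m}. 0)"
      by (intro tendsto_intros bounded_inner_tendsto_0 bounded_y r0 Sbd E0) auto
    moreover have "y k \<bullet> r k - (\<Sum>i\<in>{1..<m}. S i k \<bullet> E i k) = (\<Sum>i\<in>{1..m}. S i k \<bullet> Z i k)" for k
    proof -
      have "y k \<bullet> r k = (\<Sum>i\<in>{1..m}. S i k \<bullet> y k)" by (simp add: r_def inner_sum_right inner_commute)
      moreover have "(\<Sum>i\<in>{1..<m}. S i k \<bullet> E i k) = (\<Sum>i\<in>{1..m}. S i k \<bullet> E i k)"
        unfolding sum_split_last by (simp add: E_def Z_def)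
      ultimately show ?thesis by (simp add: E_def inner_diff_right flip: sum_subtractf)
    qed
    ultimately show ?thesis by simp
  qed
  have h_eq: "h k = (\<Sum>i\<in>{1..m}. S i k \<bullet> Z i k) - (\<Sum>i\<in>{1..m}. S i k \<bullet> w i + Z i k \<bullet> t i - t i \<bullet> w i)" for k
    unfolding h_def sum_subtractf[symmetric]
    by (intro sum.cong) (simp_all add: inner_diff_left inner_diff_right inner_commute)
  have "(h \<longlongrightarrow> 0 - (\<Sum>i\<in>{1..m}. a i \<bullet> w i + yb \<bullet> t i - t i \<bullet> w i)) G"
    unfolding h_eq[abs_def] by (intro tendsto_intros seqG[OF cross] Slim Zlim)
  moreover have "0 - (\<Sum>i\<in>{1..m}. a i \<bullet> w i + yb \<bullet> t i - t i \<bullet> w i) = - (\<Sum>i\<in>{1..m}. (norm (yb - w i))\<^sup>2)"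
  proof -
    have "(\<Sum>i\<in>{1..m}. a i \<bullet> yb) = 0" using suma by (simp flip: inner_sum_left)
    then have "0 - (\<Sum>i\<in>{1..m}. a i \<bullet> w i + yb \<bullet> t i - t i \<bullet> w i)
        = (\<Sum>i\<in>{1..m}. a i \<bullet> yb - (a i \<bullet> w i + yb \<bullet> t i - t i \<bullet> w i))" by (simp add: sum_subtractf)
    also have "\<dots> = (\<Sum>i\<in>{1..m}. - (norm (yb - w i))\<^sup>2)"
      by (intro sum.cong) (simp_all add: t_def power2_norm_eq_inner inner_diff_left inner_diff_right
          inner_add_left inner_add_right inner_commute)
    finally show ?thesis by (simp add: sum_negf)
  qed
  ultimately have "(h \<longlongrightarrow> - (\<Sum>i\<in>{1..m}. (norm (yb - w i))\<^sup>2)) G" by (simp only:)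
  then have "0 \<le> - (\<Sum>i\<in>{1..m}. (norm (yb - w i))\<^sup>2)"
    by (rule tendsto_lowerbound) (use G(2) h_nonneg in auto)
  then have "(\<Sum>i\<in>{1..m}. (norm (yb - w i))\<^sup>2) = 0"
    by (smt (verit) sum_nonneg zero_le_power2)
  then have "w i = yb" if "i \<in> {1..m}" for i
    using that by (subst (asm) sum_nonneg_eq_0_iff) auto
  then have "a i \<in> A i yb" if "i \<in> {1..m}" for i using w[OF that] that by simp
  then have "solution yb a" using suma by (simp add: solution_def)
  moreover have "fixed_point yb a i = xb i" if "i \<in> {1..<m}" for i
    using that lam(1)[OF that] gamma by (simp add: fixed_point_def a_def)
  ultimately show ?thesis using that by blast
qed

text \<open>Both cluster points give fixed points, so the difference of the two energies converges. Up to a constant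
  it is linear in \<open>x\<close>, and its limits along the two filters can agree only if the fixed points do.\<close>

lemma cluster_points_unique:
  assumes G1: "G1 \<le> sequentially" "G1 \<noteq> bot"
    "\<And>v. ((\<lambda>k. y k \<bullet> v) \<longlongrightarrow> y1 \<bullet> v) G1" "\<And>i v. i \<in> {1..<m} \<Longrightarrow> ((\<lambda>k. x i k \<bullet> v) \<longlongrightarrow> x1 i \<bullet> v) G1"
    and G2: "G2 \<le> sequentially" "G2 \<noteq> bot"
    "\<And>v. ((\<lambda>k. y k \<bullet> v) \<longlongrightarrow> y2 \<bullet> v) G2" "\<And>i v. i \<in> {1..<m} \<Longrightarrow> ((\<lambda>k. x i k \<bullet> v) \<longlongrightarrow> x2 i \<bullet> v) G2"
  shows "y1 = y2"
proof -
  obtain a1 where a1: "solution y1 a1" "\<And>i. i \<in> {1..<m} \<Longrightarrow> fixed_point y1 a1 i = x1 i"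
    using cluster_point_solution[OF G1] by blast
  obtain a2 where a2: "solution y2 a2" "\<And>i. i \<in> {1..<m} \<Longrightarrow> fixed_point y2 a2 i = x2 i"
    using cluster_point_solution[OF G2] by blast
  have c1: "convergent (\<lambda>k. energy (\<lambda>i. x i k - x1 i))"
    using energy_convergent[OF a1(1)] a1(2) by (simp add: energy_def)
  have c2: "convergent (\<lambda>k. energy (\<lambda>i. x i k - x2 i))"
    using energy_convergent[OF a2(1)] a2(2) by (simp add: energy_def)
  define h where "h k = (\<Sum>i\<in>{1..<m}. lam i * (x i k \<bullet> (x1 i - x2 i)))" for k
  have "energy (\<lambda>i. x i k - x2 i) - energy (\<lambda>i. x i k - x1 i) = 2 * h k + (energy x2 - energy x1)" for k
    unfolding energy_def h_def sum_distrib_left sum_subtractf[symmetric] sum.distrib[symmetric]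
    by (intro sum.cong) (simp_all add: power2_norm_eq_inner inner_diff_left inner_diff_right inner_commute algebra_simps)
  then have h_eq: "h k = (energy (\<lambda>i. x i k - x2 i) - energy (\<lambda>i. x i k - x1 i) - (energy x2 - energy x1)) / 2" for k
    by simp
  obtain L1 L2 where L: "(\<lambda>k. energy (\<lambda>i. x i k - x1 i)) \<longlonglongrightarrow> L1" "(\<lambda>k. energy (\<lambda>i. x i k - x2 i)) \<longlonglongrightarrow> L2"
    using c1 c2 by (auto simp: convergent_def)
  have h: "h \<longlonglongrightarrow> (L2 - L1 - (energy x2 - energy x1)) / 2"
    unfolding h_eq[abs_def] by (intro tendsto_intros L) simp
  have h1: "(h \<longlongrightarrow> (\<Sum>i\<in>{1..<m}. lam i * (x1 i \<bullet> (x1 i - x2 i)))) G1"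
    unfolding h_def[abs_def] by (intro tendsto_intros G1(4))
  have h2: "(h \<longlongrightarrow> (\<Sum>i\<in>{1..<m}. lam i * (x2 i \<bullet> (x1 i - x2 i)))) G2"
    unfolding h_def[abs_def] by (intro tendsto_intros G2(4))
  have "(\<Sum>i\<in>{1..<m}. lam i * (x1 i \<bullet> (x1 i - x2 i))) = (\<Sum>i\<in>{1..<m}. lam i * (x2 i \<bullet> (x1 i - x2 i)))"
    using tendsto_unique[OF G1(2) h1 tendsto_mono[OF G1(1) h]]
      tendsto_unique[OF G2(2) h2 tendsto_mono[OF G2(1) h]] by simp
  then have "energy (\<lambda>i. x1 i - x2 i) = 0"
    unfolding energy_def power2_norm_eq_inner
    by (simp add: inner_diff_left[of "x1 _" "x2 _"] right_diff_distrib sum_subtractf)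
  moreover have one: "1 \<in> {1..<m}" using m by simp
  ultimately have "x1 1 = x2 1"
    using energy_component[OF one, of "\<lambda>i. x1 i - x2 i"] by simp
  with a1(2)[OF one] a2(2)[OF one] have "fixed_point y1 a1 1 = fixed_point y2 a2 1" by simp
  with resolvent_nonexpansive[OF one fixed_point_resolved[OF a1(1)] fixed_point_resolved[OF a2(1)]]
  show "y1 = y2" by simp
qed

text \<open>If some functional did not converge along \<open>y\<close>, the indices where it stays away from the limit would carry
  a weak cluster point of their own, contrary to uniqueness.\<close>

theorem weak_convergence:
  obtains yb a where "solution yb a" "weakly_tendsto y yb" "\<And>i. i \<in> {1..<m} \<Longrightarrow> weakly_tendsto (z i) yb"
proof -
  obtain B where B: "\<And>k. norm (y k) \<le> B" using bounded_y by (auto simp: bounded_iff)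
  have "\<exists>C. \<forall>k. i \<in> {1..<m} \<longrightarrow> norm (x i k) \<le> C" for i
    using bounded_x[of i] by (auto simp: bounded_iff)
  then obtain C where C: "\<And>i k. i \<in> {1..<m} \<Longrightarrow> norm (x i k) \<le> C i" by metis
  \<comment> \<open>Index \<open>0\<close> carries \<open>y\<close>, so that \<open>y\<close> and all \<open>x i\<close> cluster along the same filter.\<close>
  define W where "W i k = (if i \<in> {1..<m} then x i k else y k)" for i k
  define M where "M i = (if i \<in> {1..<m} then C i else B)" for i
  have W: "norm (W i k) \<le> M i" for i k using B C by (simp add: W_def M_def)
  have cluster: "\<exists>G yb xb. G \<le> F \<and> G \<noteq> bot \<and> (\<forall>v. ((\<lambda>k. y k \<bullet> v) \<longlongrightarrow> yb \<bullet> v) G) \<and>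
      (\<forall>i\<in>{1..<m}. \<forall>v. ((\<lambda>k. x i k \<bullet> v) \<longlongrightarrow> xb i \<bullet> v) G)" if F: "F \<noteq> bot" for F
  proof -
    obtain G l where G: "G \<le> F" "G \<noteq> bot" "\<And>i v. ((\<lambda>k. W i k \<bullet> v) \<longlongrightarrow> l i \<bullet> v) G"
      using weak_cluster_point[OF F, of W M] W by metis
    have "((\<lambda>k. y k \<bullet> v) \<longlongrightarrow> l 0 \<bullet> v) G" for v using G(3)[of 0 v] by (simp add: W_def)
    moreover have "((\<lambda>k. x i k \<bullet> v) \<longlongrightarrow> l i \<bullet> v) G" if "i \<in> {1..<m}" for i v
      using G(3)[of i v] that by (simp add: W_def)
    ultimately show ?thesis using G(1,2) by blast
  qed
  obtain G yb xb where G: "G \<le> sequentially" "G \<noteq> bot" "\<And>v. ((\<lambda>k. y k \<bullet> v) \<longlongrightarrow> yb \<bullet> v) G"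
    "\<And>i v. i \<in> {1..<m} \<Longrightarrow> ((\<lambda>k. x i k \<bullet> v) \<longlongrightarrow> xb i \<bullet> v) G"
    using cluster[OF sequentially_bot] by blast
  obtain a where a: "solution yb a" using cluster_point_solution[OF G] by blast
  have y: "(\<lambda>k. y k \<bullet> u) \<longlonglongrightarrow> yb \<bullet> u" for u
  proof (rule ccontr)
    assume "\<not> (\<lambda>k. y k \<bullet> u) \<longlonglongrightarrow> yb \<bullet> u"
    then obtain \<epsilon> where e: "\<epsilon> > 0" and ev: "\<not> (\<forall>\<^sub>F k in sequentially. dist (y k \<bullet> u) (yb \<bullet> u) < \<epsilon>)"
      by (auto simp: tendsto_iff)
    define F where "F = inf sequentially (principal {k. \<not> dist (y k \<bullet> u) (yb \<bullet> u) < \<epsilon>})"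
    have "F \<noteq> bot"
      using ev by (auto simp: F_def trivial_limit_def eventually_inf_principal)
    from cluster[OF this] obtain G' yb' xb' where G': "G' \<le> F" "G' \<noteq> bot"
      "\<And>v. ((\<lambda>k. y k \<bullet> v) \<longlongrightarrow> yb' \<bullet> v) G'"
      "\<And>i v. i \<in> {1..<m} \<Longrightarrow> ((\<lambda>k. x i k \<bullet> v) \<longlongrightarrow> xb' i \<bullet> v) G'" by blast
    have "G' \<le> sequentially" using G'(1) by (simp add: F_def)
    then have "yb' = yb" using cluster_points_unique[OF _ G'(2-4) G] by blast
    then have "\<forall>\<^sub>F k in G'. dist (y k \<bullet> u) (yb \<bullet> u) < \<epsilon>" using G'(3)[of u] e by (auto simp: tendsto_iff)
    moreover have "\<forall>\<^sub>F k in G'. \<not> dist (y k \<bullet> u) (yb \<bullet> u) < \<epsilon>"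
      by (rule filter_leD[OF G'(1)]) (simp add: F_def eventually_inf_principal)
    ultimately have "\<forall>\<^sub>F k in G'. False" by eventually_elim simp
    with G'(2) show False by (simp add: trivial_limit_def)
  qed
  have "(\<lambda>k. z i k \<bullet> u) \<longlonglongrightarrow> yb \<bullet> u" if "i \<in> {1..<m}" for i u
    using tendsto_diff[OF y[of u] tendsto_inner[OF residual_tendsto_0[OF that] tendsto_const[of u]]]
    by (simp add: inner_diff_left)
  with a y show ?thesis using that by (simp add: weakly_tendsto_def)
qed

end

section \<open>Convergence of the proximal splitting\<close>

lemma prox_resolved:
  fixes f :: "nat \<Rightarrow> 'a::real_inner \<Rightarrow> ereal"
  assumes sp: "splitting m \<sigma> lam \<mu> \<gamma> (\<lambda>i. strong_subgradients (\<sigma> i) (f i))"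
    and f: "\<And>i. i \<in> {1..m} \<Longrightarrow> proper_fun (f i) \<and> sigma_convex (\<sigma> i) (f i)"
    and Z: "\<And>i. i \<in> {1..<m} \<Longrightarrow> Z i \<in> prox (\<gamma> / lam i) (f i) (X i)"
    and Y: "Y \<in> prox \<gamma> (f m) (\<Sum>i\<in>{1..<m}. lam i *\<^sub>R (2 *\<^sub>R Z i - X i))"
  shows "splitting.resolved m lam \<gamma> (\<lambda>i. strong_subgradients (\<sigma> i) (f i)) X Z Y"
proof -
  interpret splitting m \<sigma> lam \<mu> \<gamma> "\<lambda>i. strong_subgradients (\<sigma> i) (f i)" by (rule sp)
  have "(lam i / \<gamma>) *\<^sub>R (X i - Z i) \<in> strong_subgradients (\<sigma> i) (f i) (Z i)" if i: "i \<in> {1..<m}" for i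
    using prox_strong_subgradient[OF _ _ _ Z[OF i], of "\<sigma> i"] f[of i] i lam(1)[OF i] gamma by simp
  moreover have "(1 / \<gamma>) *\<^sub>R ((\<Sum>i\<in>{1..<m}. lam i *\<^sub>R (2 *\<^sub>R Z i - X i)) - Y) \<in> strong_subgradients (\<sigma> m) (f m) Y"
    using prox_strong_subgradient[OF _ _ gamma Y, of "\<sigma> m"] f[of m] m by simp
  ultimately show ?thesis by (simp add: resolved_def)
qed

theorem theorem5p2:
  fixes m :: nat
    and f :: "nat \<Rightarrow> 'a::{real_inner, complete_space} \<Rightarrow> ereal"
    and \<sigma> lam :: "nat \<Rightarrow> real"
    and \<mu> \<gamma> :: real
    and lstar :: ereal
    and x z :: "nat \<Rightarrow> nat \<Rightarrow> 'a"
    and y :: "nat \<Rightarrow> 'a"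
  assumes m: "m \<ge> 2"
    and f: "\<And>i. i \<in> {1..m} \<Longrightarrow> proper_fun (f i) \<and> closed_fun (f i) \<and> sigma_convex (\<sigma> i) (f i)"
    and zer: "zer (\<lambda>u. \<Sum>i=1..m. subdiff (f i) u) \<noteq> {}"
    and mu: "0 < \<mu>" "\<mu> < 2"
    and lam: "\<And>i. i \<in> {1..<m} \<Longrightarrow> lam i > 0" "(\<Sum>i\<in>{1..<m}. lam i) = 1"
    and cases: "nonconvex_case m \<sigma> \<mu> lam lstar \<or> convex_case m \<sigma> lstar"
    and gamma: "0 < \<gamma>" "ereal \<gamma> < lstar"
    and z_step: "\<And>i k. i \<in> {1..<m} \<Longrightarrow> z i k \<in> prox (\<gamma> / lam i) (f i) (x i k)"
    and y_step: "\<And>k. y k \<in> prox \<gamma> (f m) (\<Sum>i\<in>{1..<m}. lam i *\<^sub>R (2 *\<^sub>R z i k - x i k))"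
    and x_step: "\<And>i k. i \<in> {1..<m} \<Longrightarrow> x i (Suc k) = x i k + \<mu> *\<^sub>R (y k - z i k)"
  shows
    "(bounded (range y) \<and> (\<forall>i\<in>{1..<m}. bounded (range (x i)) \<and> bounded (range (z i))))
     \<and> ((\<lambda>k. norm (y (Suc k) - y k)) \<in> o(\<lambda>k. 1 / sqrt (real k)) \<and>
        (\<forall>i\<in>{1..<m}. (\<lambda>k. norm (x i (Suc k) - x i k)) \<in> o(\<lambda>k. 1 / sqrt (real k)) \<and>
                     (\<lambda>k. norm (z i (Suc k) - z i k)) \<in> o(\<lambda>k. 1 / sqrt (real k))))
     \<and> (nonconvex_case m \<sigma> \<mu> lam lstar \<or> (convex_case m \<sigma> lstar \<and> (\<exists>j\<in>{1..m}. \<sigma> j > 0)) \<longrightarrow>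
          (\<exists>zbar. argmin (\<lambda>u. \<Sum>i=1..m. f i u) = {zbar} \<and>
             y \<longlonglongrightarrow> zbar \<and> (\<forall>i\<in>{1..<m}. z i \<longlonglongrightarrow> zbar)))
     \<and> (convex_case m \<sigma> lstar \<and> (\<forall>i\<in>{1..m}. \<sigma> i = 0) \<longrightarrow>
          (\<exists>zbar\<in>argmin (\<lambda>u. \<Sum>i=1..m. f i u).
             weakly_tendsto y zbar \<and> (\<forall>i\<in>{1..<m}. weakly_tendsto (z i) zbar)))"
proof -
  define S where "S i = strong_subgradients (\<sigma> i) (f i)" for i
  have proper: "proper_fun (f i)" and closed: "closed_fun (f i)" and conv: "sigma_convex (\<sigma> i) (f i)"
    if "i \<in> {1..m}" for i using f[OF that] by auto
  have below: "ereal \<gamma> < lstar" by (rule gamma(2))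
  interpret splitting m \<sigma> lam \<mu> \<gamma> S
    by unfold_locales (use m mu gamma lam strong_subgradients_monotone[OF proper] in \<open>auto simp: S_def\<close>)
  have step: "resolved (\<lambda>i. x i k) (\<lambda>i. z i k) (y k)" for k
    unfolding S_def[abs_def]
    by (rule prox_resolved[OF splitting_axioms[unfolded S_def[abs_def]]])
      (use proper conv z_step y_step in auto)
  interpret splitting_iteration m \<sigma> lam \<mu> \<gamma> S x z y
    by unfold_locales (use step x_step in auto)
  obtain u where u: "0 \<in> (\<Sum>i=1..m. subdiff (f i) u)" using zer by (auto simp: zer_def)
  then have "\<exists>v. 0 = (\<Sum>i\<in>{1..m}. v i) \<and> (\<forall>i\<in>{1..m}. v i \<in> subdiff (f i) u)"
    unfolding set_sum_alt[OF finite_atLeastAtMost] by blast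
  then obtain v where v: "\<And>i. i \<in> {1..m} \<Longrightarrow> v i \<in> subdiff (f i) u" "(\<Sum>i\<in>{1..m}. v i) = 0"
    by metis
  have sol: "solution u v"
    using v subdiff_strong_subgradient[OF proper conv] by (auto simp: solution_def S_def)
  have zero: "0 \<in> strong_subgradients (\<Sum>i=1..m. \<sigma> i) (\<lambda>w. \<Sum>i=1..m. f i w) w" if "solution w a" for w a
    using sum_strong_subgradients[of "{1..m}" a \<sigma> f w] proper that by (simp add: solution_def S_def)
  \<comment> \<open>The rate of the increments of \<open>x\<close> is common to both cases.\<close>
  have rates_x: "\<forall>i\<in>{1..<m}. (\<lambda>k. norm (x i (Suc k) - x i k)) \<in> o(\<lambda>k. 1 / sqrt (real k))"
    if "dissipative_iteration m \<sigma> lam \<mu> \<gamma> S x z y \<kappa> u v" for \<kappa>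
    using dissipative_iteration.gap_bounded_rate[OF that gap_bounded_increment] by blast
  show ?thesis
  proof (cases "nonconvex_case m \<sigma> \<mu> lam lstar \<or> (convex_case m \<sigma> lstar \<and> (\<exists>j\<in>{1..m}. \<sigma> j > 0))")
    \<comment> \<open>The dissipation controls \<open>q\<close>: the zero \<open>u\<close> is the strong limit and the unique minimizer.\<close>
    case strong: True
    have pos: "(\<Sum>i=1..m. \<sigma> i) > 0"
      using strong
    proof
      assume "convex_case m \<sigma> lstar \<and> (\<exists>j\<in>{1..m}. \<sigma> j > 0)"
      then show ?thesis by (auto simp: convex_case_def intro!: sum_pos2)
    qed (simp add: nonconvex_case_def)
    have "\<exists>\<kappa>>0. \<forall>p q. \<kappa> * (energy (\<lambda>i. q - p i) + (norm q)\<^sup>2) \<le> dissipation p q"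
      using strong
    proof
      assume "nonconvex_case m \<sigma> \<mu> lam lstar"
      then have "ereal \<gamma> < P_optval m \<sigma> \<mu> lam" using below by (simp add: nonconvex_case_def)
      then obtain lbar \<delta> where "P_feasible m \<sigma> \<mu> lam \<delta> lbar" "\<gamma> < lbar"
        by (auto simp: P_optval_def less_Sup_iff)
      then show ?thesis using dissipation_margin_feasible by metis
    next
      assume "convex_case m \<sigma> lstar \<and> (\<exists>j\<in>{1..m}. \<sigma> j > 0)"
      then obtain j where "\<And>i. i \<in> {1..m} \<Longrightarrow> 0 \<le> \<sigma> i" "j \<in> {1..m}" "\<sigma> j > 0"
        by (auto simp: convex_case_def)
      then show ?thesis using dissipation_margin_convex[of j] by metis
    qed
    then obtain \<kappa> where \<kappa>: "\<kappa> > 0"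
      and margin: "\<And>p q. \<kappa> * (energy (\<lambda>i. q - p i) + (norm q)\<^sup>2) \<le> dissipation p q" by blast
    have dis: "\<kappa> * energy (\<lambda>i. q - p i) \<le> dissipation p q" and coer: "\<kappa> * (norm q)\<^sup>2 \<le> dissipation p q" for p q
      using margin[of q p] \<kappa> energy_nonneg[of "\<lambda>i. q - p i"]
      by (smt (verit) distrib_left mult_nonneg_nonneg zero_le_power2)+
    interpret dissipative_iteration m \<sigma> lam \<mu> \<gamma> S x z y \<kappa> u v
      by unfold_locales (use \<kappa> dis sol in auto)
    note conclusion = strong_convergence[OF coer]
    have fin: "(\<Sum>i=1..m. f i u) \<noteq> -\<infinity>"
    proof -
      have "\<exists>a. i \<in> {1..m} \<longrightarrow> f i u = ereal a" for i
        using edom_real[OF proper] v(1) by (metis (no_types, lifting) mem_Collect_eq subdiff_def)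
      then obtain a where "\<And>i. i \<in> {1..m} \<Longrightarrow> f i u = ereal (a i)" by metis
      then have "(\<Sum>i=1..m. f i u) = ereal (\<Sum>i=1..m. a i)" by simp
      then show ?thesis by simp
    qed
    have "argmin (\<lambda>u. \<Sum>i=1..m. f i u) = {u}"
      by (rule zero_strong_subgradient_unique_argmin[OF zero[OF sol] fin pos])
    then have unique: "\<exists>zbar. argmin (\<lambda>u. \<Sum>i=1..m. f i u) = {zbar} \<and>
             y \<longlonglongrightarrow> zbar \<and> (\<forall>i\<in>{1..<m}. z i \<longlonglongrightarrow> zbar)"
      using conclusion(1,2) by blast
    have "\<not> (\<forall>i\<in>{1..m}. \<sigma> i = 0)" using pos sum.neutral[of "{1..m}" \<sigma>] by fastforce
    moreover have "bounded (range (x i)) \<and> bounded (range (z i))" if "i \<in> {1..<m}" for i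
      using bounded_x[OF that] bounded_z_iff[OF that] conclusion(4) by blast
    moreover have "(\<lambda>k. norm (z i (Suc k) - z i k)) \<in> o(\<lambda>k. 1 / sqrt (real k))" if "i \<in> {1..<m}" for i
      using gap_bounded_rate gap_bounded_difference_iff[OF that] conclusion(3) by blast
    ultimately show ?thesis
      using unique gap_bounded_rate[OF conclusion(3)] conclusion(4) rates_x[OF dissipative_iteration_axioms] by blast
  next
    \<comment> \<open>All moduli vanish, and the dissipation is a multiple of the residual energy.\<close>
    case zero_moduli: False
    then have "convex_case m \<sigma> lstar" using cases by blast
    with zero_moduli have \<sigma>0: "\<sigma> i = 0" if "i \<in> {1..m}" for i
      using that unfolding convex_case_def by (metis order_le_imp_less_or_eq)
    have "\<mu> * (2 - \<mu>) * energy (\<lambda>i. q - p i) \<le> dissipation p q" for p q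
      using \<sigma>0 m by (simp add: dissipation_def)
    moreover have "\<exists>w'. w - w' \<in> S i w'" if i: "i \<in> {1..m}" for i w
    proof -
      have "v i \<in> S i u" using sol i by (simp add: solution_def)
      then have "v i \<in> strong_subgradients 0 (f i) u" by (simp add: S_def \<sigma>0[OF i])
      then show ?thesis
        using resolvent_surjective[OF proper[OF i] closed[OF i]] conv[OF i] \<sigma>0[OF i] by (simp add: S_def)
    qed
    ultimately interpret monotone_iteration m \<sigma> lam \<mu> \<gamma> S x z y "\<mu> * (2 - \<mu>)" u v
      by unfold_locales (use mu sol \<sigma>0 in auto)
    obtain zbar a where "solution zbar a" and weak: "weakly_tendsto y zbar"
      "\<And>i. i \<in> {1..<m} \<Longrightarrow> weakly_tendsto (z i) zbar" using weak_convergence by blast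
    then have "0 \<in> strong_subgradients 0 (\<lambda>w. \<Sum>i=1..m. f i w) zbar" using zero \<sigma>0 by simp
    then have "zbar \<in> argmin (\<lambda>w. \<Sum>i=1..m. f i w)" by (rule zero_strong_subgradient_argmin)
    then show ?thesis
      using weak zero_moduli bounded_x bounded_y bounded_z gap_bounded_rate[OF gap_bounded_y]
        gap_bounded_rate[OF gap_bounded_z] rates_x[OF dissipative_iteration_axioms] by blast
  qed
qed

end
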